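(* Let $M$ be a totally umbilical STCR lightlike submanifold of an indefinite Kähler manifold $\bar M$. If the distribution $D_0$ is integrable, then the induced connection $\nabla$ on $M$ is a metric connection.
   Context: Indefinite Kähler manifold $(\bar M,\bar J,\bar g)$: a semi-Riemannian manifold of constant index $q$, $0<q<\dim\bar M$, with an almost complex structure $\bar J$ ($\bar J^2=-I$) satisfying $\bar g(\bar JX,\bar JY)=\bar g(X,Y)$ and $\bar\nabla\bar J=0$, where $\bar\nabla$ is the Levi-Civita connection of $\bar g$. Lightlike submanifold: a submanifold $M$ of dimension $m$ of $\bar M$ (of dimension $m+n$), with induced metric $g$, such that $Rad(TM)=TM\cap TM^\perp$ has constant rank $r$, $1\le r\le m$. One fixes non-degenerate complements: a screen distribution $S(TM)$ with $TM=S(TM)\perp Rad(TM)$ and a screen transversal bundle $S(TM^\perp)$ with $TM^\perp=S(TM^\perp)\perp Rad(TM)$. The lightlike transversal bundle $ltr(TM)$ is a rank $r$ complement of $Rad(TM)$ in the orthogonal complement of $S(TM)\perp S(TM^\perp)$ in $T\bar M|_M$, locally spanned by $N_1,\dots,N_r$ with $\bar g(\xi_i,N_j)=\delta_{ij}$, $\bar g(N_i,N_j)=0$ for a local basis $\{\xi_i\}$ of $Rad(TM)$. Put $tr(TM)=ltr(TM)\perp S(TM^\perp)$; then $T\bar M|_M=TM\oplus tr(TM)$. STCR (screen transversal Cauchy Riemann) lightlike submanifold: a real lightlike submanifold $M$ of $\bar M$ such that (A) there are subbundles $D_1,D_2$ of $Rad(TM)$ with $Rad(TM)=D_1\oplus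 D_2$, $\bar J(D_1)\subset S(TM)$, $\bar J(D_2)\subset S(TM^\perp)$; (B) there are subbundles $D_0,D'$ of $S(TM)$ with $S(TM)=\{\bar JD_1\oplus D'\}\perp D_0$, $\bar J(D_0)=D_0$, $\bar J(D')=L_1\perp S$, where $D_0$ is non-degenerate and $L_1$, $S$ are vector subbundles of $ltr(TM)$ and $S(TM^\perp)$ respectively. Induced connection and second fundamental form: $\bar\nabla_XY=\nabla_XY+h(X,Y)$ for $X,Y\in\Gamma(TM)$, with $\nabla_XY\in\Gamma(TM)$, $h(X,Y)\in\Gamma(tr(TM))$. $M$ is totally umbilical if there is a smooth transversal vector field $H\in\Gamma(tr(TM))$ with $h(X,Y)=g(X,Y)H$ for all $X,Y\in\Gamma(TM)$. The induced connection is a metric connection if $\nabla g=0$.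
   Formalization: The distribution D_0 is assumed non-zero; for D_0 = 0 the claim fails, e.g. for the light cone of R^k_1 in C^k (k ≥ 3), which is a totally umbilical STCR lightlike submanifold whose induced connection is not metric. *)

theory Defs
  imports "HOL-Analysis.Analysis"
begin

section \<open>Smooth manifolds\<close>

text \<open>\<open>Ck_on\<close> and \<open>smooth_on\<close> are only used on open sets: all directional derivatives of every
  order exist and are (differentiable, hence) continuous.\<close>

primrec Ck_on :: "nat \<Rightarrow> 'e::euclidean_space set \<Rightarrow> ('e \<Rightarrow> 'v::real_normed_vector) \<Rightarrow> bool" where
  "Ck_on 0 S F \<longleftrightarrow> continuous_on S F"
| "Ck_on (Suc k) S F \<longleftrightarrow>
     (\<forall>x\<in>S. F differentiable (at x)) \<and> (\<forall>v. Ck_on k S (\<lambda>x. frechet_derivative F (at x) v))"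

definition smooth_on :: "'e::euclidean_space set \<Rightarrow> ('e \<Rightarrow> 'v::real_normed_vector) \<Rightarrow> bool" where
  "smooth_on S F \<longleftrightarrow> (\<forall>k. Ck_on k S F)"

text \<open>A chart is a pair of its domain and its coordinate map (whose values off the domain are
  irrelevant). A manifold is a type, second countable and Hausdorff by its sort, with an atlas.\<close>

type_synonym ('a, 'e) chart = "'a set \<times> ('a \<Rightarrow> 'e)"

definition chart_inv :: "('a, 'e) chart \<Rightarrow> 'e \<Rightarrow> 'a" where
  "chart_inv c = inv_into (fst c) (snd c)"

definition smooth_atlas :: "('a::topological_space, 'e::euclidean_space) chart set \<Rightarrow> bool" where
  "smooth_atlas A \<longleftrightarrow>
     (\<Union>c\<in>A. fst c) = UNIV \<and>
     (\<forall>c\<in>A. open (fst c) \<and> open (snd c ` fst c) \<and>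
        homeomorphism (fst c) (snd c ` fst c) (snd c) (chart_inv c)) \<and>
     (\<forall>c\<in>A. \<forall>d\<in>A. smooth_on (snd c ` (fst c \<inter> fst d)) (snd d \<circ> chart_inv c))"

text \<open>The tangent space at \<open>p\<close> is the model space \<open>'e\<close>: a vector \<open>v :: 'e\<close> stands for the tangent
  vector at \<open>p\<close> whose components in the selected chart \<open>chart_at A p\<close> are \<open>v\<close>. Thus \<open>v\<close> has
  components \<open>chart_change (chart_at A p) c p v\<close> in an arbitrary chart \<open>c\<close>.\<close>

definition chart_at :: "('a, 'e) chart set \<Rightarrow> 'a \<Rightarrow> ('a, 'e) chart" where
  "chart_at A p = (SOME c. c \<in> A \<and> p \<in> fst c)"

definition chart_change ::
    "('a, 'e::euclidean_space) chart \<Rightarrow> ('a, 'e) chart \<Rightarrow> 'a \<Rightarrow> 'e \<Rightarrow> 'e" where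
  "chart_change c d p = frechet_derivative (snd d \<circ> chart_inv c) (at (snd c p))"

text \<open>The coordinate vector field of the chart \<open>c\<close> in the direction \<open>v\<close>, at the point \<open>p\<close>.\<close>

definition coord_field ::
    "('a, 'e::euclidean_space) chart set \<Rightarrow> ('a, 'e) chart \<Rightarrow> 'e \<Rightarrow> 'a \<Rightarrow> 'e" where
  "coord_field A c v p = chart_change c (chart_at A p) p v"

text \<open>In the following the atlas \<open>B\<close> belongs to the source and \<open>A\<close> to the target of the map \<open>f\<close>.\<close>

definition smooth_map ::
    "('b::topological_space, 'f::euclidean_space) chart set \<Rightarrow>
     ('a::topological_space, 'e::euclidean_space) chart set \<Rightarrow> ('b \<Rightarrow> 'a) \<Rightarrow> bool" where
  "smooth_map B A f \<longleftrightarrow> continuous_on UNIV f \<and>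
     (\<forall>c\<in>B. \<forall>d\<in>A. smooth_on (snd c ` (fst c \<inter> f -` fst d)) (snd d \<circ> f \<circ> chart_inv c))"

definition tangent_map ::
    "('b, 'f::euclidean_space) chart set \<Rightarrow> ('a, 'e::euclidean_space) chart set \<Rightarrow>
     ('b \<Rightarrow> 'a) \<Rightarrow> 'b \<Rightarrow> 'f \<Rightarrow> 'e" where
  "tangent_map B A f p =
     frechet_derivative (snd (chart_at A (f p)) \<circ> f \<circ> chart_inv (chart_at B p))
       (at (snd (chart_at B p) p))"

definition immersed_submanifold ::
    "('b::topological_space, 'f::euclidean_space) chart set \<Rightarrow>
     ('a::topological_space, 'e::euclidean_space) chart set \<Rightarrow> ('b \<Rightarrow> 'a) \<Rightarrow> bool" where
  "immersed_submanifold B A f \<longleftrightarrow>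
     smooth_atlas B \<and> smooth_map B A f \<and> inj f \<and> (\<forall>p. inj (tangent_map B A f p))"

text \<open>Derivative of a real function in the direction of a tangent vector.\<close>

definition dir_deriv ::
    "('b, 'f::euclidean_space) chart set \<Rightarrow> ('b \<Rightarrow> real) \<Rightarrow> 'b \<Rightarrow> 'f \<Rightarrow> real" where
  "dir_deriv B F p =
     frechet_derivative (F \<circ> chart_inv (chart_at B p)) (at (snd (chart_at B p) p))"


section \<open>Vector fields and connections\<close>

text \<open>A vector field along \<open>f\<close> is a section \<open>V\<close> of the pull-back of the tangent bundle, that is
  \<open>V p\<close> is tangent to the target at \<open>f p\<close>. The components in the target chart \<open>d\<close> are expressed as
  functions of the coordinates in the source chart \<open>c\<close>. Vector fields on a manifold are the case
  of the identity map.\<close>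

definition field_rep ::
    "('a, 'e::euclidean_space) chart set \<Rightarrow> ('b \<Rightarrow> 'a) \<Rightarrow> ('b, 'f) chart \<Rightarrow> ('a, 'e) chart \<Rightarrow>
     ('b \<Rightarrow> 'e) \<Rightarrow> 'f \<Rightarrow> 'e" where
  "field_rep A f c d V = (\<lambda>x. let p = chart_inv c x
     in chart_change (chart_at A (f p)) d (f p) (V p))"

definition smooth_field_along ::
    "('b::topological_space, 'f::euclidean_space) chart set \<Rightarrow>
     ('a::topological_space, 'e::euclidean_space) chart set \<Rightarrow> ('b \<Rightarrow> 'a) \<Rightarrow>
     'b set \<Rightarrow> ('b \<Rightarrow> 'e) \<Rightarrow> bool" where
  "smooth_field_along B A f U V \<longleftrightarrow>
     (\<forall>c\<in>B. \<forall>d\<in>A. smooth_on (snd c ` (fst c \<inter> U \<inter> f -` fst d)) (field_rep A f c d V))"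

definition smooth_field ::
    "('b::topological_space, 'f::euclidean_space) chart set \<Rightarrow> ('b \<Rightarrow> 'f) \<Rightarrow> bool" where
  "smooth_field B X \<longleftrightarrow> smooth_field_along B B (\<lambda>p. p) UNIV X"

text \<open>Components \<open>X\<^sup>i \<partial>\<^sub>i Y\<^sup>j - Y\<^sup>i \<partial>\<^sub>i X\<^sup>j\<close> of the Lie bracket.\<close>

definition lie_bracket ::
    "('a, 'e::euclidean_space) chart set \<Rightarrow> ('a \<Rightarrow> 'e) \<Rightarrow> ('a \<Rightarrow> 'e) \<Rightarrow> 'a \<Rightarrow> 'e" where
  "lie_bracket A X Y p =
     (let c = chart_at A p in
        frechet_derivative (field_rep A (\<lambda>p. p) c c Y) (at (snd c p)) (X p) -
        frechet_derivative (field_rep A (\<lambda>p. p) c c X) (at (snd c p)) (Y p))"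

text \<open>An affine connection is given by the bilinear maps \<open>C p\<close>, its Christoffel symbols at \<open>p\<close>
  with respect to the chart \<open>chart_at A p\<close>. \<open>cov_deriv A C B f V p v\<close> is the covariant derivative
  at \<open>p\<close>, in the direction of the tangent vector \<open>v\<close> of the source, of the vector field \<open>V\<close> along
  \<open>f\<close> (pull-back connection). For an immersion \<open>f\<close> this is the derivative
  of an ambient field defined only along the submanifold in a tangential direction.\<close>

definition cov_deriv ::
    "('a, 'e::euclidean_space) chart set \<Rightarrow> ('a \<Rightarrow> 'e \<Rightarrow> 'e \<Rightarrow> 'e) \<Rightarrow>
     ('b, 'f::euclidean_space) chart set \<Rightarrow> ('b \<Rightarrow> 'a) \<Rightarrow> ('b \<Rightarrow> 'e) \<Rightarrow> 'b \<Rightarrow> 'f \<Rightarrow> 'e" where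
  "cov_deriv A C B f V p v =
     frechet_derivative (field_rep A f (chart_at B p) (chart_at A (f p)) V)
       (at (snd (chart_at B p) p)) v
     + C (f p) (tangent_map B A f p v) (V p)"

abbreviation ambient_deriv ::
    "('a, 'e::euclidean_space) chart set \<Rightarrow> ('a \<Rightarrow> 'e \<Rightarrow> 'e \<Rightarrow> 'e) \<Rightarrow>
     ('a \<Rightarrow> 'e) \<Rightarrow> ('a \<Rightarrow> 'e) \<Rightarrow> 'a \<Rightarrow> 'e" where
  "ambient_deriv A C X Y p \<equiv> cov_deriv A C A (\<lambda>q. q) Y p (X p)"

text \<open>Smoothness of a connection is smoothness of its Christoffel symbols in each chart.\<close>

definition affine_connection ::
    "('a::topological_space, 'e::euclidean_space) chart set \<Rightarrow> ('a \<Rightarrow> 'e \<Rightarrow> 'e \<Rightarrow> 'e) \<Rightarrow> bool" where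
  "affine_connection A C \<longleftrightarrow>
     (\<forall>p. bilinear (C p)) \<and>
     (\<forall>c\<in>A. \<forall>v w. smooth_on (snd c ` fst c)
        (field_rep A (\<lambda>p. p) c c (ambient_deriv A C (coord_field A c v) (coord_field A c w))))"


section \<open>Indefinite Kaehler manifolds\<close>

definition nondegenerate_on :: "('e::euclidean_space \<Rightarrow> 'e \<Rightarrow> real) \<Rightarrow> 'e set \<Rightarrow> bool" where
  "nondegenerate_on b W \<longleftrightarrow> (\<forall>v\<in>W. (\<forall>w\<in>W. b v w = 0) \<longrightarrow> v = 0)"

definition negative_definite_on :: "('e::euclidean_space \<Rightarrow> 'e \<Rightarrow> real) \<Rightarrow> 'e set \<Rightarrow> bool" where
  "negative_definite_on b W \<longleftrightarrow> (\<forall>v\<in>W. v \<noteq> 0 \<longrightarrow> b v v < 0)"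

text \<open>The index is the largest dimension of a negative definite subspace.\<close>

definition form_index :: "('e::euclidean_space \<Rightarrow> 'e \<Rightarrow> real) \<Rightarrow> nat" where
  "form_index b = Max {dim W |W. subspace W \<and> negative_definite_on b W}"

definition semi_riemannian_metric ::
    "('a::topological_space, 'e::euclidean_space) chart set \<Rightarrow> ('a \<Rightarrow> 'e \<Rightarrow> 'e \<Rightarrow> real) \<Rightarrow>
     nat \<Rightarrow> bool" where
  "semi_riemannian_metric A g q \<longleftrightarrow>
     (\<forall>p. bilinear (g p) \<and> (\<forall>v w. g p v w = g p w v) \<and> nondegenerate_on (g p) UNIV \<and>
        form_index (g p) = q) \<and>
     (\<forall>c\<in>A. \<forall>v w. smooth_on (snd c ` fst c)
        ((\<lambda>p. g p (coord_field A c v p) (coord_field A c w p)) \<circ> chart_inv c))"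

definition levi_civita ::
    "('a::topological_space, 'e::euclidean_space) chart set \<Rightarrow> ('a \<Rightarrow> 'e \<Rightarrow> 'e \<Rightarrow> real) \<Rightarrow>
     ('a \<Rightarrow> 'e \<Rightarrow> 'e \<Rightarrow> 'e) \<Rightarrow> bool" where
  "levi_civita A g C \<longleftrightarrow>
     affine_connection A C \<and>
     (\<forall>X Y p. smooth_field A X \<longrightarrow> smooth_field A Y \<longrightarrow>
        ambient_deriv A C X Y p - ambient_deriv A C Y X p = lie_bracket A X Y p) \<and>
     (\<forall>X Y Z p. smooth_field A X \<longrightarrow> smooth_field A Y \<longrightarrow> smooth_field A Z \<longrightarrow>
        dir_deriv A (\<lambda>p. g p (Y p) (Z p)) p (X p) =
          g p (ambient_deriv A C X Y p) (Z p) + g p (Y p) (ambient_deriv A C X Z p))"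

definition almost_complex_structure ::
    "('a::topological_space, 'e::euclidean_space) chart set \<Rightarrow> ('a \<Rightarrow> 'e \<Rightarrow> 'e) \<Rightarrow> bool" where
  "almost_complex_structure A J \<longleftrightarrow>
     (\<forall>p. linear (J p) \<and> (\<forall>v. J p (J p v) = - v)) \<and>
     (\<forall>c\<in>A. \<forall>v. smooth_on (snd c ` fst c)
        (field_rep A (\<lambda>p. p) c c (\<lambda>p. J p (coord_field A c v p))))"

definition indefinite_kaehler ::
    "('a::topological_space, 'e::euclidean_space) chart set \<Rightarrow> ('a \<Rightarrow> 'e \<Rightarrow> 'e) \<Rightarrow>
     ('a \<Rightarrow> 'e \<Rightarrow> 'e \<Rightarrow> real) \<Rightarrow> ('a \<Rightarrow> 'e \<Rightarrow> 'e \<Rightarrow> 'e) \<Rightarrow> bool" where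
  "indefinite_kaehler A J g C \<longleftrightarrow>
     smooth_atlas A \<and>
     (\<exists>q. 0 < q \<and> q < DIM('e) \<and> semi_riemannian_metric A g q) \<and>
     levi_civita A g C \<and>
     almost_complex_structure A J \<and>
     (\<forall>p v w. g p (J p v) (J p w) = g p v w) \<and>
     (\<forall>X Y p. smooth_field A X \<longrightarrow> smooth_field A Y \<longrightarrow>
        ambient_deriv A C X (\<lambda>q. J q (Y q)) p - J p (ambient_deriv A C X Y p) = 0)"


section \<open>Lightlike submanifolds\<close>

text \<open>All bundles over the submanifold are families of subspaces of the ambient tangent spaces; in
  particular the tangent space of the submanifold is identified with the range of the differential
  of the immersion \<open>f\<close>. A subbundle of rank \<open>k\<close> has local smooth frames; rank zero is allowed.\<close>

definition subbundle_rank ::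
    "('b::topological_space, 'f::euclidean_space) chart set \<Rightarrow>
     ('a::topological_space, 'e::euclidean_space) chart set \<Rightarrow> ('b \<Rightarrow> 'a) \<Rightarrow>
     nat \<Rightarrow> ('b \<Rightarrow> 'e set) \<Rightarrow> bool" where
  "subbundle_rank B A f k E \<longleftrightarrow>
     (\<forall>p. \<exists>U s. open U \<and> p \<in> U \<and> (\<forall>i<k. smooth_field_along B A f U (s i)) \<and>
        (\<forall>q\<in>U. E q = span ((\<lambda>i. s i q) ` {..<k}) \<and> dim (E q) = k))"

definition subbundle ::
    "('b::topological_space, 'f::euclidean_space) chart set \<Rightarrow>
     ('a::topological_space, 'e::euclidean_space) chart set \<Rightarrow> ('b \<Rightarrow> 'a) \<Rightarrow>
     ('b \<Rightarrow> 'e set) \<Rightarrow> bool" where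
  "subbundle B A f E \<longleftrightarrow> (\<exists>k. subbundle_rank B A f k E)"

definition is_direct_sum :: "'e::real_vector set \<Rightarrow> 'e set \<Rightarrow> 'e set \<Rightarrow> bool" where
  "is_direct_sum W U V \<longleftrightarrow> W = {u + v |u v. u \<in> U \<and> v \<in> V} \<and> U \<inter> V = {0}"

definition is_orthogonal_sum ::
    "('e::real_vector \<Rightarrow> 'e \<Rightarrow> real) \<Rightarrow> 'e set \<Rightarrow> 'e set \<Rightarrow> 'e set \<Rightarrow> bool" where
  "is_orthogonal_sum b W U V \<longleftrightarrow> is_direct_sum W U V \<and> (\<forall>u\<in>U. \<forall>v\<in>V. b u v = 0)"

definition orth_space :: "('e::real_vector \<Rightarrow> 'e \<Rightarrow> real) \<Rightarrow> 'e set \<Rightarrow> 'e set" where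
  "orth_space b W = {v. \<forall>w\<in>W. b v w = 0}"

definition tangent_space ::
    "('b, 'f::euclidean_space) chart set \<Rightarrow> ('a, 'e::euclidean_space) chart set \<Rightarrow>
     ('b \<Rightarrow> 'a) \<Rightarrow> 'b \<Rightarrow> 'e set" where
  "tangent_space B A f p = range (tangent_map B A f p)"

definition normal_space ::
    "('b, 'f::euclidean_space) chart set \<Rightarrow> ('a, 'e::euclidean_space) chart set \<Rightarrow>
     ('a \<Rightarrow> 'e \<Rightarrow> 'e \<Rightarrow> real) \<Rightarrow> ('b \<Rightarrow> 'a) \<Rightarrow> 'b \<Rightarrow> 'e set" where
  "normal_space B A g f p = orth_space (g (f p)) (tangent_space B A f p)"

definition radical ::
    "('b, 'f::euclidean_space) chart set \<Rightarrow> ('a, 'e::euclidean_space) chart set \<Rightarrow>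
     ('a \<Rightarrow> 'e \<Rightarrow> 'e \<Rightarrow> real) \<Rightarrow> ('b \<Rightarrow> 'a) \<Rightarrow> 'b \<Rightarrow> 'e set" where
  "radical B A g f p = tangent_space B A f p \<inter> normal_space B A g f p"

definition screen_distribution ::
    "('b::topological_space, 'f::euclidean_space) chart set \<Rightarrow>
     ('a::topological_space, 'e::euclidean_space) chart set \<Rightarrow>
     ('a \<Rightarrow> 'e \<Rightarrow> 'e \<Rightarrow> real) \<Rightarrow> ('b \<Rightarrow> 'a) \<Rightarrow> ('b \<Rightarrow> 'e set) \<Rightarrow> bool" where
  "screen_distribution B A g f S \<longleftrightarrow> subbundle B A f S \<and>
     (\<forall>p. nondegenerate_on (g (f p)) (S p) \<and>
        is_orthogonal_sum (g (f p)) (tangent_space B A f p) (S p) (radical B A g f p))"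

definition screen_transversal_bundle ::
    "('b::topological_space, 'f::euclidean_space) chart set \<Rightarrow>
     ('a::topological_space, 'e::euclidean_space) chart set \<Rightarrow>
     ('a \<Rightarrow> 'e \<Rightarrow> 'e \<Rightarrow> real) \<Rightarrow> ('b \<Rightarrow> 'a) \<Rightarrow> ('b \<Rightarrow> 'e set) \<Rightarrow> bool" where
  "screen_transversal_bundle B A g f St \<longleftrightarrow> subbundle B A f St \<and>
     (\<forall>p. nondegenerate_on (g (f p)) (St p) \<and>
        is_orthogonal_sum (g (f p)) (normal_space B A g f p) (St p) (radical B A g f p))"

definition lightlike_transversal_bundle ::
    "('b::topological_space, 'f::euclidean_space) chart set \<Rightarrow>
     ('a::topological_space, 'e::euclidean_space) chart set \<Rightarrow>
     ('a \<Rightarrow> 'e \<Rightarrow> 'e \<Rightarrow> real) \<Rightarrow> ('b \<Rightarrow> 'a) \<Rightarrow> nat \<Rightarrow>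
     ('b \<Rightarrow> 'e set) \<Rightarrow> ('b \<Rightarrow> 'e set) \<Rightarrow> ('b \<Rightarrow> 'e set) \<Rightarrow> bool" where
  "lightlike_transversal_bundle B A g f r S St L \<longleftrightarrow>
     subbundle_rank B A f r L \<and>
     (\<forall>p. is_direct_sum (orth_space (g (f p)) (S p \<union> St p)) (radical B A g f p) (L p)) \<and>
     (\<forall>p. \<exists>U \<xi> N. open U \<and> p \<in> U \<and>
        (\<forall>i<r. smooth_field_along B A f U (\<xi> i) \<and> smooth_field_along B A f U (N i)) \<and>
        (\<forall>q\<in>U. radical B A g f q = span ((\<lambda>i. \<xi> i q) ` {..<r}) \<and>
           L q = span ((\<lambda>i. N i q) ` {..<r}) \<and>
           (\<forall>i<r. \<forall>j<r. g (f q) (\<xi> i q) (N j q) = (if i = j then 1 else 0) \<and>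
              g (f q) (N i q) (N j q) = 0)))"

definition lightlike_submanifold ::
    "('b::topological_space, 'f::euclidean_space) chart set \<Rightarrow>
     ('a::topological_space, 'e::euclidean_space) chart set \<Rightarrow>
     ('a \<Rightarrow> 'e \<Rightarrow> 'e \<Rightarrow> real) \<Rightarrow> ('b \<Rightarrow> 'a) \<Rightarrow>
     ('b \<Rightarrow> 'e set) \<Rightarrow> ('b \<Rightarrow> 'e set) \<Rightarrow> ('b \<Rightarrow> 'e set) \<Rightarrow> bool" where
  "lightlike_submanifold B A g f S St L \<longleftrightarrow>
     immersed_submanifold B A f \<and>
     (\<exists>r. 1 \<le> r \<and> r \<le> DIM('f) \<and> (\<forall>p. dim (radical B A g f p) = r) \<and>
        screen_distribution B A g f S \<and> screen_transversal_bundle B A g f St \<and>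
        lightlike_transversal_bundle B A g f r S St L)"

text \<open>\<open>D0\<close> is an argument because integrability is a property of this distribution. Rank zero is
  not excluded here; integrability of \<open>D0\<close> is then void and carries no information (the light cone
  of a Lagrangian subspace of flat space is totally umbilical with \<open>D0 = 0\<close>, but its induced
  connection is not metric).\<close>

definition STCR_lightlike_submanifold ::
    "('b::topological_space, 'f::euclidean_space) chart set \<Rightarrow>
     ('a::topological_space, 'e::euclidean_space) chart set \<Rightarrow> ('a \<Rightarrow> 'e \<Rightarrow> 'e) \<Rightarrow>
     ('a \<Rightarrow> 'e \<Rightarrow> 'e \<Rightarrow> real) \<Rightarrow> ('b \<Rightarrow> 'a) \<Rightarrow>
     ('b \<Rightarrow> 'e set) \<Rightarrow> ('b \<Rightarrow> 'e set) \<Rightarrow> ('b \<Rightarrow> 'e set) \<Rightarrow> ('b \<Rightarrow> 'e set) \<Rightarrow> bool" where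
  "STCR_lightlike_submanifold B A J g f S St L D0 \<longleftrightarrow>
     lightlike_submanifold B A g f S St L \<and>
     (\<exists>D1 D2 D' L1 S'.
        (\<forall>E\<in>{D0, D1, D2, D', L1, S'}. subbundle B A f E) \<and>
        (\<forall>p. is_direct_sum (radical B A g f p) (D1 p) (D2 p) \<and>
           J (f p) ` D1 p \<subseteq> S p \<and>
           J (f p) ` D2 p \<subseteq> St p) \<and>
        (\<forall>p. (\<exists>W. is_direct_sum W (J (f p) ` D1 p) (D' p) \<and>
                 is_orthogonal_sum (g (f p)) (S p) W (D0 p)) \<and>
           nondegenerate_on (g (f p)) (D0 p) \<and>
           J (f p) ` D0 p = D0 p \<and>
           L1 p \<subseteq> L p \<and> S' p \<subseteq> St p \<and>
           is_orthogonal_sum (g (f p)) (J (f p) ` D' p) (L1 p) (S' p)))"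


section \<open>Induced connection\<close>

definition transversal_space ::
    "('b \<Rightarrow> 'e::real_vector set) \<Rightarrow> ('b \<Rightarrow> 'e set) \<Rightarrow> 'b \<Rightarrow> 'e set" where
  "transversal_space St L p = {u + v |u v. u \<in> L p \<and> v \<in> St p}"

text \<open>Vector fields \<open>X\<close>, \<open>Y\<close> on the submanifold take values in its own model space; the
  corresponding ambient field is \<open>push B A f Y\<close>. The Gauss formula splits the ambient derivative
  into the tangential \<open>induced_connection\<close> and the transversal \<open>second_fund_form\<close>.\<close>

definition push ::
    "('b, 'f::euclidean_space) chart set \<Rightarrow> ('a, 'e::euclidean_space) chart set \<Rightarrow>
     ('b \<Rightarrow> 'a) \<Rightarrow> ('b \<Rightarrow> 'f) \<Rightarrow> 'b \<Rightarrow> 'e" where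
  "push B A f Y p = tangent_map B A f p (Y p)"

definition induced_metric ::
    "('b, 'f::euclidean_space) chart set \<Rightarrow> ('a, 'e::euclidean_space) chart set \<Rightarrow>
     ('a \<Rightarrow> 'e \<Rightarrow> 'e \<Rightarrow> real) \<Rightarrow> ('b \<Rightarrow> 'a) \<Rightarrow> 'b \<Rightarrow> 'f \<Rightarrow> 'f \<Rightarrow> real" where
  "induced_metric B A g f p v w = g (f p) (tangent_map B A f p v) (tangent_map B A f p w)"

definition induced_connection ::
    "('b, 'f::euclidean_space) chart set \<Rightarrow> ('a, 'e::euclidean_space) chart set \<Rightarrow>
     ('a \<Rightarrow> 'e \<Rightarrow> 'e \<Rightarrow> 'e) \<Rightarrow> ('b \<Rightarrow> 'a) \<Rightarrow> ('b \<Rightarrow> 'e set) \<Rightarrow> ('b \<Rightarrow> 'e set) \<Rightarrow>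
     ('b \<Rightarrow> 'f) \<Rightarrow> ('b \<Rightarrow> 'f) \<Rightarrow> 'b \<Rightarrow> 'f" where
  "induced_connection B A C f St L X Y p =
     (THE u. cov_deriv A C B f (push B A f Y) p (X p) - tangent_map B A f p u
        \<in> transversal_space St L p)"

definition second_fund_form ::
    "('b, 'f::euclidean_space) chart set \<Rightarrow> ('a, 'e::euclidean_space) chart set \<Rightarrow>
     ('a \<Rightarrow> 'e \<Rightarrow> 'e \<Rightarrow> 'e) \<Rightarrow> ('b \<Rightarrow> 'a) \<Rightarrow> ('b \<Rightarrow> 'e set) \<Rightarrow> ('b \<Rightarrow> 'e set) \<Rightarrow>
     ('b \<Rightarrow> 'f) \<Rightarrow> ('b \<Rightarrow> 'f) \<Rightarrow> 'b \<Rightarrow> 'e" where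
  "second_fund_form B A C f St L X Y p =
     cov_deriv A C B f (push B A f Y) p (X p) -
     tangent_map B A f p (induced_connection B A C f St L X Y p)"

definition totally_umbilical ::
    "('b::topological_space, 'f::euclidean_space) chart set \<Rightarrow>
     ('a::topological_space, 'e::euclidean_space) chart set \<Rightarrow>
     ('a \<Rightarrow> 'e \<Rightarrow> 'e \<Rightarrow> real) \<Rightarrow> ('a \<Rightarrow> 'e \<Rightarrow> 'e \<Rightarrow> 'e) \<Rightarrow> ('b \<Rightarrow> 'a) \<Rightarrow>
     ('b \<Rightarrow> 'e set) \<Rightarrow> ('b \<Rightarrow> 'e set) \<Rightarrow> bool" where
  "totally_umbilical B A g C f St L \<longleftrightarrow>
     (\<exists>H. smooth_field_along B A f UNIV H \<and> (\<forall>p. H p \<in> transversal_space St L p) \<and>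
        (\<forall>X Y p. smooth_field B X \<longrightarrow> smooth_field B Y \<longrightarrow>
           second_fund_form B A C f St L X Y p =
             induced_metric B A g f p (X p) (Y p) *\<^sub>R H p))"

definition metric_connection ::
    "('b::topological_space, 'f::euclidean_space) chart set \<Rightarrow> ('b \<Rightarrow> 'f \<Rightarrow> 'f \<Rightarrow> real) \<Rightarrow>
     (('b \<Rightarrow> 'f) \<Rightarrow> ('b \<Rightarrow> 'f) \<Rightarrow> 'b \<Rightarrow> 'f) \<Rightarrow> bool" where
  "metric_connection B g nabla \<longleftrightarrow>
     (\<forall>X Y Z p. smooth_field B X \<longrightarrow> smooth_field B Y \<longrightarrow> smooth_field B Z \<longrightarrow>
        dir_deriv B (\<lambda>q. g q (Y q) (Z q)) p (X p)
          - g p (nabla X Y p) (Z p) - g p (Y p) (nabla X Z p) = 0)"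

text \<open>A distribution is integrable if an integral manifold passes through every point. Around the
  point the integral manifold is parametrised by a subspace \<open>K\<close> of the model space (of dimension
  the rank of the distribution); composing the parametrisation with a projection
  onto \<open>K\<close> one may take it to be defined on the whole model space.\<close>

definition integrable_distribution ::
    "('b::topological_space, 'f::euclidean_space) chart set \<Rightarrow> ('b \<Rightarrow> 'f set) \<Rightarrow> bool" where
  "integrable_distribution B D \<longleftrightarrow>
     (\<forall>p. \<exists>K u. subspace K \<and> smooth_map {(UNIV, \<lambda>x::'f. x)} B u \<and> u (0::'f) = p \<and> inj_on u K \<and>
        (\<forall>x\<in>K. inj_on (tangent_map {(UNIV, \<lambda>x::'f. x)} B u x) K \<and>
           tangent_map {(UNIV, \<lambda>x::'f. x)} B u x ` K = D (u x)))"

end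

theory Submission
  imports Defs
begin

text \<open>For vector fields \<open>X\<close>, \<open>Y\<close> in \<open>D\<^sub>0\<close>, parallelism of \<open>J\<close> gives that the ambient derivative of
  \<open>J Y\<close> in the direction \<open>X\<close>, antisymmetrised in \<open>X\<close> and \<open>Y\<close>, is \<open>J [X, Y]\<close>. As \<open>D\<^sub>0\<close> is integrable and
  complex, this is tangent to \<open>M\<close>, so \<open>h(X, J Y) = h(Y, J X)\<close>. By umbilicity
  \<open>2 g(X, J Y) H = 0\<close>, and since \<open>D\<^sub>0\<close> is non-zero, non-degenerate and complex, \<open>H = 0\<close>. Hence \<open>h = 0\<close>:
  the ambient derivative of tangent fields is the induced connection, which inherits metricity.

  Instead of extending \<open>X\<close>, \<open>Y\<close> to sections of \<open>D\<^sub>0\<close>, the computation is made on an integral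
  manifold \<open>u\<close> with coordinate fields, whose brackets vanish by symmetry of second derivatives.\<close>

subsection \<open>Calculus of smooth functions\<close>

text \<open>The hypotheses speak of global smooth fields, whereas an integral manifold offers only
  fields along \<open>u\<close>. They meet at a single point: bump functions turn the global
  statements into identities for the Christoffel symbols, the metric and the complex structure in
  the selected chart, and umbilicity into a statement on the second derivative of \<open>f\<close>
  modulo tangent vectors. Such identities can be pulled back along any map. A second obstacle:
  \<open>J\<close> of a coordinate field of \<open>u\<close> takes values in the tangent spaces of
  the submanifold, but is not given as the image of a differentiable field of its model space. Its
  derivative is still known modulo tangent vectors, by a closedness argument on ranges of linear
  maps. The factor 2 comes from skew symmetry: \<open>h(X, J Y)\<close> is symmetric in
  \<open>X\<close> and \<open>Y\<close> by the bracket argument, while \<open>g(X, J Y)\<close> is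
  skew because \<open>J\<close> is an isometry with square -1. The cancellation takes place modulo
  the tangent space; \<open>H\<close> then vanishes because it is also transversal.\<close>

lemma frechet_derivative_eqI:
  "(F has_derivative F') (at x) \<Longrightarrow> frechet_derivative F (at x) = F'"
  by (rule frechet_derivative_at [symmetric])

text \<open>On an open set a derivative depends only on the values in the set. Chart inverses and
  component functions have arbitrary values off the chart image, so smoothness claims about them
  pass through this congruence.\<close>

lemma Ck_on_cong:
  fixes F G :: "'e::euclidean_space \<Rightarrow> 'v::real_normed_vector"
  assumes "open S" "\<And>x. x \<in> S \<Longrightarrow> F x = G x" "Ck_on k S F"
  shows "Ck_on k S G"
  using assms(2,3)
proof (induction k arbitrary: F G)
  case 0
  then show ?case by (auto cong: continuous_on_cong_simp)
next
  case (Suc k)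
  have *: "(G has_derivative frechet_derivative F (at x)) (at x)" if "x \<in> S" for x
  proof -
    have "(F has_derivative frechet_derivative F (at x)) (at x)"
      using Suc.prems(2) that by (simp add: frechet_derivative_works)
    then show ?thesis
      using assms(1) that Suc.prems(1) by (rule has_derivative_transform_within_open)
  qed
  have "Ck_on k S (\<lambda>x. frechet_derivative G (at x) v)" for v
  proof (rule Suc.IH)
    show "frechet_derivative F (at x) v = frechet_derivative G (at x) v" if "x \<in> S" for x
      using frechet_derivative_eqI[OF *[OF that]] by simp
    show "Ck_on k S (\<lambda>x. frechet_derivative F (at x) v)"
      using Suc.prems(2) by simp
  qed
  then show ?case
    using * by (auto simp: differentiable_def)
qed

lemma Ck_on_imp_continuous_on: "Ck_on k S F \<Longrightarrow> continuous_on S F"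
  by (cases k) (auto intro!: continuous_at_imp_continuous_on differentiable_imp_continuous_within)

lemma Ck_on_SucD: "Ck_on (Suc k) S F \<Longrightarrow> Ck_on k S F"
proof (induction k arbitrary: F)
  case 0
  then show ?case by (simp add: Ck_on_imp_continuous_on[OF 0])
next
  case (Suc k)
  have "Ck_on k S (\<lambda>x. frechet_derivative F (at x) v)" for v
    using Suc.prems by (intro Suc.IH) simp
  then show ?case
    using Suc.prems by simp
qed

lemma Ck_on_SucI:
  fixes F :: "'e::euclidean_space \<Rightarrow> 'v::real_normed_vector"
  assumes "open S" "\<And>x. x \<in> S \<Longrightarrow> (F has_derivative F' x) (at x)"
    and "\<And>v. Ck_on k S (\<lambda>x. F' x v)"
  shows "Ck_on (Suc k) S F"
proof -
  have "Ck_on k S (\<lambda>x. frechet_derivative F (at x) v)" for v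
    using assms(1) _ assms(3)
    by (rule Ck_on_cong) (simp add: frechet_derivative_eqI[OF assms(2)])
  then show ?thesis
    using assms(2) by (auto simp: differentiable_def)
qed

lemma Ck_on_SucE:
  assumes "Ck_on (Suc k) S F" "x \<in> S"
  shows "(F has_derivative frechet_derivative F (at x)) (at x)"
  using assms by (simp add: frechet_derivative_works)

lemma Ck_on_const: "open S \<Longrightarrow> Ck_on k S (\<lambda>x. c)"
proof (induction k arbitrary: c)
  case 0
  then show ?case by simp
next
  case (Suc k)
  then show ?case by (intro Ck_on_SucI[where F' = "\<lambda>x v. 0"]) auto
qed

lemma Ck_on_bounded_linear:
  assumes "open S" "bounded_linear L"
  shows "Ck_on k S F \<Longrightarrow> Ck_on k S (\<lambda>x. L (F x))"
proof (induction k arbitrary: F)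
  case 0
  then show ?case
    using bounded_linear.continuous_on[OF assms(2)] by auto
next
  case (Suc k)
  show ?case
  proof (rule Ck_on_SucI[OF assms(1)])
    show "((\<lambda>x. L (F x)) has_derivative (\<lambda>v. L (frechet_derivative F (at x) v))) (at x)"
      if "x \<in> S" for x
      using bounded_linear.has_derivative[OF assms(2) Ck_on_SucE[OF Suc.prems that]] .
    show "Ck_on k S (\<lambda>x. L (frechet_derivative F (at x) v))" for v
      using Suc.prems by (intro Suc.IH) simp
  qed
qed

lemma Ck_on_add:
  assumes "open S"
  shows "Ck_on k S F \<Longrightarrow> Ck_on k S G \<Longrightarrow> Ck_on k S (\<lambda>x. F x + G x)"
proof (induction k arbitrary: F G)
  case 0
  then show ?case by (auto intro: continuous_on_add)
next
  case (Suc k)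
  show ?case
  proof (rule Ck_on_SucI[OF assms])
    show "((\<lambda>x. F x + G x) has_derivative
        (\<lambda>v. frechet_derivative F (at x) v + frechet_derivative G (at x) v)) (at x)"
      if "x \<in> S" for x
      using Ck_on_SucE[OF Suc.prems(1) that] Ck_on_SucE[OF Suc.prems(2) that]
      by (rule has_derivative_add)
    show "Ck_on k S (\<lambda>x. frechet_derivative F (at x) v + frechet_derivative G (at x) v)" for v
      using Suc.prems by (intro Suc.IH) simp_all
  qed
qed

lemma Ck_on_sum:
  assumes "open S" "finite I" "\<And>i. i \<in> I \<Longrightarrow> Ck_on k S (F i)"
  shows "Ck_on k S (\<lambda>x. \<Sum>i\<in>I. F i x)"
  using assms(2,3)
  by (induction I rule: finite_induct) (auto intro: Ck_on_const Ck_on_add assms(1))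

lemma Ck_on_scaleR:
  fixes a :: "'e::euclidean_space \<Rightarrow> real" and F :: "'e \<Rightarrow> 'v::real_normed_vector"
  assumes "open S"
  shows "Ck_on k S a \<Longrightarrow> Ck_on k S F \<Longrightarrow> Ck_on k S (\<lambda>x. a x *\<^sub>R F x)"
proof (induction k arbitrary: a F)
  case 0
  then show ?case by (auto intro: continuous_on_scaleR)
next
  case (Suc k)
  show ?case
  proof (rule Ck_on_SucI[OF assms])
    show "((\<lambda>x. a x *\<^sub>R F x) has_derivative
        (\<lambda>v. a x *\<^sub>R frechet_derivative F (at x) v + frechet_derivative a (at x) v *\<^sub>R F x)) (at x)"
      if "x \<in> S" for x
      using Ck_on_SucE[OF Suc.prems(1) that] Ck_on_SucE[OF Suc.prems(2) that]
      by (rule has_derivative_scaleR)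
    show "Ck_on k S (\<lambda>x. a x *\<^sub>R frechet_derivative F (at x) v +
        frechet_derivative a (at x) v *\<^sub>R F x)" for v
      using Ck_on_SucD[OF Suc.prems(1)] Ck_on_SucD[OF Suc.prems(2)] Suc.prems
      by (intro Ck_on_add[OF assms] Suc.IH) simp_all
  qed
qed

lemma linear_euclidean_expand:
  fixes L :: "'e::euclidean_space \<Rightarrow> 'v::real_vector"
  assumes "linear L"
  shows "L v = (\<Sum>i\<in>Basis. (v \<bullet> i) *\<^sub>R L i)"
  by (metis (no_types, lifting) assms euclidean_representation linear_scale linear_sum sum.cong)

text \<open>The derivative of the composition applies a linear map that varies with \<open>x\<close>
  to a vector that varies with \<open>x\<close>, while \<open>Ck_on\<close> only knows fixed
  directions. Expanding the inner derivative in the basis leaves scalar functions times derivatives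
  of \<open>G\<close> in basis directions, to which the induction hypothesis applies.\<close>

lemma Ck_on_compose:
  fixes F :: "'e::euclidean_space \<Rightarrow> 'd::euclidean_space" and G :: "'d \<Rightarrow> 'v::real_normed_vector"
  assumes "open S" "open T" "F ` S \<subseteq> T"
  shows "Ck_on k S F \<Longrightarrow> Ck_on k T G \<Longrightarrow> Ck_on k S (\<lambda>x. G (F x))"
proof (induction k arbitrary: G)
  case 0
  then show ?case
    using assms(3) by (auto intro: continuous_on_compose2)
next
  case (Suc k)
  have Fx: "F x \<in> T" if "x \<in> S" for x
    using that assms(3) by auto
  show ?case
  proof (rule Ck_on_SucI[OF assms(1)])
    fix x assume x: "x \<in> S"
    have G: "(G has_derivative frechet_derivative G (at (F x))) (at (F x))"
      by (rule Ck_on_SucE[OF Suc.prems(2) Fx[OF x]])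
    have "((\<lambda>x. G (F x)) has_derivative
        (\<lambda>v. frechet_derivative G (at (F x)) (frechet_derivative F (at x) v))) (at x)"
      using has_derivative_compose[OF Ck_on_SucE[OF Suc.prems(1) x] G] .
    then show "((\<lambda>x. G (F x)) has_derivative
        (\<lambda>v. \<Sum>i\<in>Basis. (frechet_derivative F (at x) v \<bullet> i) *\<^sub>R frechet_derivative G (at (F x)) i)) (at x)"
      by (subst (asm) linear_euclidean_expand[OF has_derivative_linear[OF G]])
  next
    fix v
    show "Ck_on k S (\<lambda>x. \<Sum>i\<in>Basis. (frechet_derivative F (at x) v \<bullet> i) *\<^sub>R
        frechet_derivative G (at (F x)) i)"
    proof (intro Ck_on_sum Ck_on_scaleR assms(1) finite_Basis)
      fix i :: 'd
      show "Ck_on k S (\<lambda>x. frechet_derivative F (at x) v \<bullet> i)"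
        using Suc.prems(1)
        by (intro Ck_on_bounded_linear[OF assms(1) bounded_linear_inner_left]) simp
      show "Ck_on k S (\<lambda>x. frechet_derivative G (at (F x)) i)"
        using Suc.prems by (intro Suc.IH Ck_on_SucD[of k S F]) simp_all
    qed
  qed
qed

lemma Ck_on_locally:
  assumes "\<And>x. x \<in> S \<Longrightarrow> \<exists>U. open U \<and> x \<in> U \<and> Ck_on k U F"
  shows "Ck_on k S F"
  using assms
proof (induction k arbitrary: F)
  case 0
  have "continuous (at x) F" if "x \<in> S" for x
    using 0[OF that] by (auto simp: continuous_on_eq_continuous_at)
  then show ?case by (simp add: continuous_at_imp_continuous_on)
next
  case (Suc k)
  have "Ck_on k S (\<lambda>x. frechet_derivative F (at x) v)" for v
  proof (rule Suc.IH)
    show "\<exists>U. open U \<and> x \<in> U \<and> Ck_on k U (\<lambda>x. frechet_derivative F (at x) v)" if "x \<in> S" for x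
      using Suc.prems[OF that] by auto
  qed
  moreover have "F differentiable (at x)" if "x \<in> S" for x
    using Suc.prems[OF that] by auto
  ultimately show ?case by simp
qed

section \<open>Closure properties of smoothness, all orders at once\<close>

lemma smooth_on_cong:
  "open S \<Longrightarrow> (\<And>x. x \<in> S \<Longrightarrow> F x = G x) \<Longrightarrow> smooth_on S F \<Longrightarrow> smooth_on S G"
  unfolding smooth_on_def using Ck_on_cong by metis

lemma smooth_on_locally:
  assumes "\<And>x. x \<in> S \<Longrightarrow> \<exists>U. open U \<and> x \<in> U \<and> smooth_on U F"
  shows "smooth_on S F"
  using assms unfolding smooth_on_def by (metis Ck_on_locally)

lemma smooth_on_subset: "smooth_on S F \<Longrightarrow> open S \<Longrightarrow> T \<subseteq> S \<Longrightarrow> smooth_on T F"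
  by (rule smooth_on_locally) blast

lemma smooth_on_compose:
  "open S \<Longrightarrow> open T \<Longrightarrow> F ` S \<subseteq> T \<Longrightarrow> smooth_on S F \<Longrightarrow> smooth_on T G \<Longrightarrow>
    smooth_on S (\<lambda>x. G (F x))"
  unfolding smooth_on_def using Ck_on_compose by blast

lemma smooth_on_scaleR:
  "open S \<Longrightarrow> smooth_on S a \<Longrightarrow> smooth_on S F \<Longrightarrow> smooth_on S (\<lambda>x. a x *\<^sub>R F x)"
  unfolding smooth_on_def using Ck_on_scaleR by blast

lemma smooth_on_add:
  "open S \<Longrightarrow> smooth_on S F \<Longrightarrow> smooth_on S G \<Longrightarrow> smooth_on S (\<lambda>x. F x + G x)"
  unfolding smooth_on_def using Ck_on_add by blast

lemma smooth_on_sum: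
  "open S \<Longrightarrow> finite I \<Longrightarrow> (\<And>i. i \<in> I \<Longrightarrow> smooth_on S (F i)) \<Longrightarrow>
    smooth_on S (\<lambda>x. \<Sum>i\<in>I. F i x)"
  unfolding smooth_on_def using Ck_on_sum by blast

lemma smooth_on_const: "open S \<Longrightarrow> smooth_on S (\<lambda>x. c)"
  unfolding smooth_on_def using Ck_on_const by blast

lemma smooth_on_bounded_linear:
  "open S \<Longrightarrow> bounded_linear L \<Longrightarrow> smooth_on S F \<Longrightarrow> smooth_on S (\<lambda>x. L (F x))"
  unfolding smooth_on_def using Ck_on_bounded_linear by blast

lemma smooth_on_has_derivative:
  "smooth_on S F \<Longrightarrow> x \<in> S \<Longrightarrow> (F has_derivative frechet_derivative F (at x)) (at x)"
  unfolding smooth_on_def using Ck_on_SucE by blast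

lemma smooth_on_frechet_derivative:
  "smooth_on S F \<Longrightarrow> smooth_on S (\<lambda>x. frechet_derivative F (at x) v)"
  unfolding smooth_on_def using Ck_on.simps(2) by blast

lemma smooth_on_ident: "open S \<Longrightarrow> smooth_on S (\<lambda>x. x)"
proof -
  assume S: "open S"
  have "Ck_on k S (\<lambda>x. x)" for k
    using S by (cases k) (auto intro: Ck_on_const)
  then show ?thesis by (simp add: smooth_on_def)
qed

lemma smooth_on_imp_continuous_on: "smooth_on S F \<Longrightarrow> continuous_on S F"
  using Ck_on_imp_continuous_on smooth_on_def by blast

text \<open>Both iterated difference quotients, evaluated by the mean value theorem, are values of a
  mixed second derivative near the point, and the second difference is symmetric.\<close>

lemma second_difference_mvt:
  fixes F :: "'e::euclidean_space \<Rightarrow> real"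
  assumes "smooth_on S F" "h > 0"
    and sub: "\<And>s t. 0 \<le> s \<Longrightarrow> s \<le> h \<Longrightarrow> 0 \<le> t \<Longrightarrow> t \<le> h \<Longrightarrow> x + s *\<^sub>R v + t *\<^sub>R w \<in> S"
  shows "\<exists>s t. 0 < s \<and> s < h \<and> 0 < t \<and> t < h \<and>
    F (x + h *\<^sub>R v + h *\<^sub>R w) - F (x + h *\<^sub>R v) - F (x + h *\<^sub>R w) + F x =
      h * (h * frechet_derivative (\<lambda>y. frechet_derivative F (at y) v)
        (at (x + s *\<^sub>R v + t *\<^sub>R w)) w)"
proof -
  define D where "D = (\<lambda>y. frechet_derivative F (at y) v)"
  have lin: "linear (frechet_derivative G (at y))" if "smooth_on S G" "y \<in> S"
    for G :: "'e \<Rightarrow> real" and y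
    using smooth_on_has_derivative[OF that] by (rule has_derivative_linear)
  have D: "smooth_on S D"
    unfolding D_def by (rule smooth_on_frechet_derivative[OF assms(1)])
  have dF: "((\<lambda>s. F (x + s *\<^sub>R v + t *\<^sub>R w)) has_real_derivative D (x + s *\<^sub>R v + t *\<^sub>R w)) (at s)"
    if "0 \<le> s" "s \<le> h" "0 \<le> t" "t \<le> h" for s t
  proof -
    have y: "x + s *\<^sub>R v + t *\<^sub>R w \<in> S" using sub that by blast
    have "((\<lambda>s. x + s *\<^sub>R v + t *\<^sub>R w) has_derivative (\<lambda>c. c *\<^sub>R v)) (at s)"
      by (auto intro!: derivative_eq_intros)
    from has_derivative_compose[OF this smooth_on_has_derivative[OF assms(1) y]]
    have "((\<lambda>s. F (x + s *\<^sub>R v + t *\<^sub>R w)) has_derivative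
      (\<lambda>c. c *\<^sub>R D (x + s *\<^sub>R v + t *\<^sub>R w))) (at s)"
      by (simp add: linear_scale[OF lin[OF assms(1) y]] D_def)
    then show ?thesis
      by (simp add: has_field_derivative_def mult_commute_abs)
  qed
  have dD: "((\<lambda>t. D (x + s *\<^sub>R v + t *\<^sub>R w)) has_real_derivative
      frechet_derivative D (at (x + s *\<^sub>R v + t *\<^sub>R w)) w) (at t)"
    if "0 \<le> s" "s \<le> h" "0 \<le> t" "t \<le> h" for s t
  proof -
    have y: "x + s *\<^sub>R v + t *\<^sub>R w \<in> S" using sub that by blast
    have "((\<lambda>t. x + s *\<^sub>R v + t *\<^sub>R w) has_derivative (\<lambda>c. c *\<^sub>R w)) (at t)"
      by (auto intro!: derivative_eq_intros)
    from has_derivative_compose[OF this smooth_on_has_derivative[OF D y]]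
    have "((\<lambda>t. D (x + s *\<^sub>R v + t *\<^sub>R w)) has_derivative
      (\<lambda>c. c *\<^sub>R frechet_derivative D (at (x + s *\<^sub>R v + t *\<^sub>R w)) w)) (at t)"
      by (simp add: linear_scale[OF lin[OF D y]])
    then show ?thesis
      by (simp add: has_field_derivative_def mult_commute_abs)
  qed
  have "\<exists>s. 0 < s \<and> s < h \<and>
    F (x + h *\<^sub>R v + h *\<^sub>R w) - F (x + h *\<^sub>R v + 0 *\<^sub>R w) -
      (F (x + 0 *\<^sub>R v + h *\<^sub>R w) - F (x + 0 *\<^sub>R v + 0 *\<^sub>R w)) =
    (h - 0) * (D (x + s *\<^sub>R v + h *\<^sub>R w) - D (x + s *\<^sub>R v + 0 *\<^sub>R w))"
    by (rule MVT2[OF \<open>h > 0\<close>], rule DERIV_diff; rule dF) (use \<open>h > 0\<close> in simp_all)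
  then obtain s where s: "0 < s" "s < h" and eqs:
    "F (x + h *\<^sub>R v + h *\<^sub>R w) - F (x + h *\<^sub>R v) - F (x + h *\<^sub>R w) + F x =
      h * (D (x + s *\<^sub>R v + h *\<^sub>R w) - D (x + s *\<^sub>R v + 0 *\<^sub>R w))"
    by auto
  have "\<exists>t. 0 < t \<and> t < h \<and> D (x + s *\<^sub>R v + h *\<^sub>R w) - D (x + s *\<^sub>R v + 0 *\<^sub>R w) =
    (h - 0) * frechet_derivative D (at (x + s *\<^sub>R v + t *\<^sub>R w)) w"
    by (rule MVT2[OF \<open>h > 0\<close>], rule dD) (use s in simp_all)
  then show ?thesis
    using s eqs unfolding D_def by auto
qed

lemma symmetric_second_derivative_real:
  fixes F :: "'e::euclidean_space \<Rightarrow> real"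
  assumes "smooth_on S F" "open S" "x \<in> S"
  shows "frechet_derivative (\<lambda>y. frechet_derivative F (at y) v) (at x) w =
    frechet_derivative (\<lambda>y. frechet_derivative F (at y) w) (at x) v"
proof -
  define P where "P = (\<lambda>v w y. frechet_derivative (\<lambda>y. frechet_derivative F (at y) v) (at y) w)"
  have contP: "isCont (P v w) x" for v w
    using smooth_on_imp_continuous_on[OF smooth_on_frechet_derivative[OF
          smooth_on_frechet_derivative[OF assms(1)]]] assms(2,3)
    unfolding P_def by (simp add: continuous_on_eq_continuous_at)
  have "\<bar>P v w x - P w v x\<bar> \<le> e" if "e > 0" for e
  proof -
    have ev: "\<forall>\<^sub>F y in nhds x. y \<in> S \<and> dist (P v w y) (P v w x) < e/2 \<and> dist (P w v y) (P w v x) < e/2"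
      using contP[of v w] contP[of w v] assms(2,3) \<open>e > 0\<close>
      using tendstoD[of "P v w" "P v w x" "nhds x" "e/2"] tendstoD[of "P w v" "P w v x" "nhds x" "e/2"]
      by (simp add: eventually_conj_iff eventually_nhds_in_open isCont_def
          tendsto_at_iff_tendsto_nhds)
    then obtain d where "d > 0" and
      d: "\<And>y. dist y x < d \<Longrightarrow> y \<in> S \<and> dist (P v w y) (P v w x) < e/2 \<and> dist (P w v y) (P w v x) < e/2"
      unfolding eventually_nhds_metric by blast
    \<comment> \<open>The parallelogram with sides \<open>h *\<^sub>R v\<close> and
      \<open>h *\<^sub>R w\<close> then stays within distance \<open>d\<close> of \<open>x\<close>;
      the summand 1 keeps the denominator positive when \<open>v = w = 0\<close>.\<close>
    define h where "h = d / (norm v + norm w + 1)"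
    have pos: "norm v + norm w + 1 > 0"
      by (simp add: add_nonneg_pos)
    have "h > 0" unfolding h_def using \<open>d > 0\<close> pos by simp
    have near: "dist (x + s *\<^sub>R v + t *\<^sub>R w) x < d" if "0 \<le> s" "s \<le> h" "0 \<le> t" "t \<le> h" for s t
    proof -
      have "dist (x + s *\<^sub>R v + t *\<^sub>R w) x = norm (s *\<^sub>R v + t *\<^sub>R w)"
        by (simp add: dist_norm)
      also have "\<dots> \<le> s * norm v + t * norm w"
        using norm_triangle_ineq[of "s *\<^sub>R v" "t *\<^sub>R w"] that by simp
      also have "\<dots> \<le> h * norm v + h * norm w"
        using that by (intro add_mono mult_right_mono) auto
      also have "\<dots> < h * (norm v + norm w + 1)"
        using \<open>h > 0\<close> by (simp add: algebra_simps)
      also have "\<dots> = d" using pos by (simp add: h_def)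
      finally show ?thesis .
    qed
    obtain s t where st: "0 < s" "s < h" "0 < t" "t < h" and
      e1: "F (x + h *\<^sub>R v + h *\<^sub>R w) - F (x + h *\<^sub>R v) - F (x + h *\<^sub>R w) + F x =
        h * (h * P v w (x + s *\<^sub>R v + t *\<^sub>R w))"
      using second_difference_mvt[OF assms(1) \<open>h > 0\<close>, of x v w] near d unfolding P_def by blast
    have near': "dist (x + s *\<^sub>R w + t *\<^sub>R v) x < d" if "0 \<le> s" "s \<le> h" "0 \<le> t" "t \<le> h" for s t
      using near[of t s] that by (simp add: algebra_simps)
    obtain s' t' where st': "0 < s'" "s' < h" "0 < t'" "t' < h" and
      e2: "F (x + h *\<^sub>R w + h *\<^sub>R v) - F (x + h *\<^sub>R w) - F (x + h *\<^sub>R v) + F x =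
        h * (h * P w v (x + s' *\<^sub>R w + t' *\<^sub>R v))"
      using second_difference_mvt[OF assms(1) \<open>h > 0\<close>, of x w v] near' d unfolding P_def by blast
    have "F (x + h *\<^sub>R w + h *\<^sub>R v) = F (x + h *\<^sub>R v + h *\<^sub>R w)"
      by (simp add: algebra_simps)
    then have "h * (h * P v w (x + s *\<^sub>R v + t *\<^sub>R w)) = h * (h * P w v (x + s' *\<^sub>R w + t' *\<^sub>R v))"
      using e1 e2 by linarith
    then have "P v w (x + s *\<^sub>R v + t *\<^sub>R w) = P w v (x + s' *\<^sub>R w + t' *\<^sub>R v)"
      using \<open>h > 0\<close> by simp
    moreover have "dist (P v w (x + s *\<^sub>R v + t *\<^sub>R w)) (P v w x) < e/2"
      using d near st by simp
    moreover have "dist (P w v (x + s' *\<^sub>R w + t' *\<^sub>R v)) (P w v x) < e/2"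
      using d near' st' by simp
    ultimately show ?thesis
      unfolding dist_real_def by linarith
  qed
  then have "\<bar>P v w x - P w v x\<bar> \<le> 0"
    by (metis field_le_epsilon add_0)
  then show ?thesis unfolding P_def by simp
qed

lemma symmetric_second_derivative:
  fixes F :: "'e::euclidean_space \<Rightarrow> 'd::euclidean_space"
  assumes "smooth_on S F" "open S" "x \<in> S"
  shows "frechet_derivative (\<lambda>y. frechet_derivative F (at y) v) (at x) w =
    frechet_derivative (\<lambda>y. frechet_derivative F (at y) w) (at x) v"
proof (rule euclidean_eqI)
  fix i :: 'd
  have G: "frechet_derivative (\<lambda>y. G y \<bullet> i) (at y) u = frechet_derivative G (at y) u \<bullet> i"
    if "smooth_on S G" "y \<in> S" for G :: "'e \<Rightarrow> 'd" and y u
    using frechet_derivative_eqI[OF bounded_linear.has_derivative[OF bounded_linear_inner_left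
          smooth_on_has_derivative[OF that]]] by simp
  have "frechet_derivative (\<lambda>y. frechet_derivative (\<lambda>y. F y \<bullet> i) (at y) u) (at x) u' =
      frechet_derivative (\<lambda>y. frechet_derivative F (at y) u) (at x) u' \<bullet> i" for u u'
  proof -
    have sm: "smooth_on S (\<lambda>y. frechet_derivative F (at y) u)"
      by (rule smooth_on_frechet_derivative[OF assms(1)])
    have "((\<lambda>y. frechet_derivative F (at y) u \<bullet> i) has_derivative
        (\<lambda>u'. frechet_derivative (\<lambda>y. frechet_derivative F (at y) u) (at x) u' \<bullet> i)) (at x)"
      using bounded_linear.has_derivative[OF bounded_linear_inner_left
          smooth_on_has_derivative[OF sm assms(3)]] .
    then have "((\<lambda>y. frechet_derivative (\<lambda>y. F y \<bullet> i) (at y) u) has_derivative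
        (\<lambda>u'. frechet_derivative (\<lambda>y. frechet_derivative F (at y) u) (at x) u' \<bullet> i)) (at x)"
      using assms(2,3) by (rule has_derivative_transform_within_open) (simp add: G[OF assms(1)])
    then show ?thesis by (simp add: frechet_derivative_eqI)
  qed
  moreover have "smooth_on S (\<lambda>y. F y \<bullet> i)"
    by (rule smooth_on_bounded_linear[OF assms(2) bounded_linear_inner_left assms(1)])
  ultimately show "frechet_derivative (\<lambda>y. frechet_derivative F (at y) v) (at x) w \<bullet> i =
    frechet_derivative (\<lambda>y. frechet_derivative F (at y) w) (at x) v \<bullet> i"
    using symmetric_second_derivative_real[OF _ assms(2,3), of "\<lambda>y. F y \<bullet> i" v w] by metis
qed

subsection \<open>Bump functions\<close>

text \<open>The flat function exp(-1/t), which is the case \<open>n = 0\<close>, with its quotients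
  by powers of \<open>t\<close>. Up to sums and scalar factors the family is closed under
  differentiation, so all its members are shown to be smooth by one induction over the
  order.\<close>

definition exp_recip :: "nat \<Rightarrow> real \<Rightarrow> real" where
  "exp_recip n t = (if t \<le> 0 then 0 else exp (- (1 / t)) / t ^ n)"

lemma exp_recip_tendsto_0: "(exp_recip n \<longlongrightarrow> 0) (at 0)"
proof -
  have "((\<lambda>t::real. (1 / t) ^ n / exp (1 / t)) \<longlongrightarrow> 0) (at_right 0)"
    by (rule filterlim_compose[OF tendsto_power_div_exp_0])
      (use filterlim_inverse_at_top_right in \<open>simp add: inverse_eq_divide\<close>)
  moreover have "\<forall>\<^sub>F t in at_right 0. (1 / t) ^ n / exp (1 / t) = exp_recip n t"
    by (auto simp: exp_recip_def eventually_at_right_field exp_minus divide_simps intro!: exI[of _ 1])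
  ultimately have "(exp_recip n \<longlongrightarrow> 0) (at_right 0)"
    by (rule Lim_transform_eventually)
  moreover have "(exp_recip n \<longlongrightarrow> 0) (at_left 0)"
    by (rule tendsto_eventually)
      (auto simp: exp_recip_def eventually_at_left_field intro!: exI[of _ "-1"])
  ultimately show ?thesis
    by (simp add: filterlim_split_at)
qed

lemma exp_recip_has_derivative:
  "(exp_recip n has_real_derivative exp_recip (n + 2) t - real n * exp_recip (n + 1) t) (at t)"
proof -
  consider "t < 0" | "t = 0" | "t > 0" by linarith
  then show ?thesis
  proof cases
    case 1
    have "((\<lambda>t. 0) has_real_derivative 0) (at t)" by simp
    then have "(exp_recip n has_real_derivative 0) (at t)"
      by (rule has_field_derivative_transform_within_open[where S = "{..<0}"])
        (use 1 in \<open>auto simp: exp_recip_def\<close>)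
    then show ?thesis using 1 by (simp add: exp_recip_def)
  next
    \<comment> \<open>At 0 the difference quotient of the \<open>n\<close>-th function is the next
      function of the family, whose limit is known.\<close>
    case 2
    have "\<forall>\<^sub>F s in at 0. exp_recip (Suc n) s = (exp_recip n s - exp_recip n 0) / (s - 0)"
      by (auto simp: exp_recip_def eventually_at_filter)
    from Lim_transform_eventually[OF exp_recip_tendsto_0 this]
    have "(exp_recip n has_real_derivative 0) (at 0)"
      by (simp add: has_field_derivative_iff)
    then show ?thesis using 2 by (simp add: exp_recip_def)
  next
    case 3
    have deriv: "((\<lambda>t. exp (- inverse t) * inverse t ^ n) has_real_derivative
        exp (- inverse t) * inverse t ^ 2 * inverse t ^ n -
        exp (- inverse t) * (real n * inverse t ^ (n - 1) * inverse t ^ 2)) (at t)"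
      using 3 by (auto intro!: derivative_eq_intros simp: power2_eq_square mult_ac)
    \<comment> \<open>For \<open>n = 0\<close> the exponent \<open>n - 1\<close> is truncated, but
      then the factor \<open>real n\<close> is zero.\<close>
    have *: "real n * inverse t ^ (n - 1) * inverse t ^ 2 = real n * inverse t ^ (n + 1)"
      by (cases n) (simp_all add: power2_eq_square)
    have "exp_recip m t = exp (- inverse t) * inverse t ^ m" for m
      using 3 by (simp add: exp_recip_def inverse_eq_divide power_divide)
    then have "((\<lambda>t. exp (- inverse t) * inverse t ^ n) has_real_derivative
        exp_recip (n + 2) t - real n * exp_recip (n + 1) t) (at t)"
      using deriv[unfolded *] by (simp add: power_add power2_eq_square mult_ac)
    then show ?thesis
      by (rule has_field_derivative_transform_within_open[where S = "{0<..}"])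
        (use 3 in \<open>auto simp: exp_recip_def divide_simps\<close>)
  qed
qed

lemma smooth_on_exp_recip: "smooth_on UNIV (exp_recip n)"
proof -
  have "Ck_on k UNIV (exp_recip n)" for k
  proof (induction k arbitrary: n)
    case 0
    show ?case
      using exp_recip_has_derivative
      by (auto intro!: continuous_at_imp_continuous_on DERIV_isCont)
  next
    case (Suc k)
    show ?case
    proof (rule Ck_on_SucI)
      show "(exp_recip n has_derivative
          (\<lambda>v. v *\<^sub>R (exp_recip (n + 2) t + (- real n) *\<^sub>R exp_recip (n + 1) t))) (at t)" for t
        using exp_recip_has_derivative[of n t]
        by (simp add: has_field_derivative_def mult.commute[of _ "_ - _"])
      show "Ck_on k UNIV
          (\<lambda>t. v *\<^sub>R (exp_recip (n + 2) t + (- real n) *\<^sub>R exp_recip (n + 1) t))" for v :: real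
        using Suc by (intro Ck_on_scaleR Ck_on_add Ck_on_const open_UNIV)
    qed simp
  qed
  then show ?thesis by (simp add: smooth_on_def)
qed

text \<open>A plateau is made by composing the flat function \<open>e\<close> with itself. While the
  squared distance \<open>q y\<close> is at most \<open>c\<close>, the inner value
  \<open>e (q y - c)\<close> is 0 and the outer value is \<open>e 1\<close>; once \<open>q y\<close>
  reaches \<open>2 * c\<close>, the squared outer radius, the inner value is at least
  \<open>e c\<close> and the outer argument is no longer positive.\<close>

lemma smooth_bump:
  fixes x :: "'e::euclidean_space"
  assumes "open S" "x \<in> S"
  shows "\<exists>b r R. smooth_on UNIV b \<and> 0 < r \<and> cball x R \<subseteq> S \<and>
    (\<forall>y\<in>ball x r. b y = 1) \<and> (\<forall>y. y \<notin> cball x R \<longrightarrow> b y = (0::real))"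
proof -
  obtain R where R: "R > 0" "cball x R \<subseteq> S"
    using assms open_contains_cball by blast
  define c where "c = R\<^sup>2 / 2"
  have c: "c > 0" using R by (simp add: c_def)
  define e where "e = exp_recip 0"
  have e: "smooth_on UNIV e" "\<And>t. t \<le> 0 \<Longrightarrow> e t = 0" "e 1 = exp (-1)"
    "\<And>t. t > 0 \<Longrightarrow> e t > 0" "\<And>s t. 0 < s \<Longrightarrow> s \<le> t \<Longrightarrow> e s \<le> e t"
    using smooth_on_exp_recip by (auto simp: e_def exp_recip_def frac_le)
  define q where "q = (\<lambda>y::'e. (y - x) \<bullet> (y - x))"
  \<comment> \<open>The factor \<open>exp 1\<close> normalises the plateau value
    \<open>e 1 = exp (-1)\<close> to 1.\<close>
  define b where "b = (\<lambda>y. exp 1 *\<^sub>R e (1 + (- 1 / e c) *\<^sub>R e (q y + (- c))))"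
  have dist: "(dist x y)\<^sup>2 = q y" for y
    unfolding q_def by (subst dist_commute) (simp add: dist_norm power2_norm_eq_inner)
  have aff: "smooth_on UNIV (\<lambda>y. (y - x) \<bullet> i)" for i
  proof -
    have "smooth_on UNIV (\<lambda>y. y \<bullet> i + (- (x \<bullet> i)))"
      by (intro smooth_on_add smooth_on_const smooth_on_bounded_linear[OF _ bounded_linear_inner_left]
          smooth_on_ident open_UNIV)
    then show ?thesis by (simp add: inner_diff_left)
  qed
  have "smooth_on UNIV (\<lambda>y. \<Sum>i\<in>Basis. ((y - x) \<bullet> i) *\<^sub>R ((y - x) \<bullet> i))"
    by (rule smooth_on_sum[OF open_UNIV finite_Basis smooth_on_scaleR[OF open_UNIV aff aff]])
  then have q: "smooth_on UNIV q"
    unfolding q_def by (subst euclidean_inner) simp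
  have comp_e: "smooth_on UNIV (\<lambda>y. e (p y))" if "smooth_on UNIV p" for p :: "'e \<Rightarrow> real"
    by (rule smooth_on_compose[OF open_UNIV open_UNIV _ that e(1)]) simp
  have b: "smooth_on UNIV b"
    unfolding b_def
    by (rule smooth_on_scaleR[OF open_UNIV smooth_on_const[OF open_UNIV]],
        rule comp_e, rule smooth_on_add[OF open_UNIV smooth_on_const[OF open_UNIV]],
        rule smooth_on_scaleR[OF open_UNIV smooth_on_const[OF open_UNIV]],
        rule comp_e, rule smooth_on_add[OF open_UNIV q smooth_on_const[OF open_UNIV]])
  have "b y = 1" if "y \<in> ball x (sqrt c)" for y
  proof -
    have "(dist x y)\<^sup>2 < c"
      using that c by (smt (verit) mem_ball real_less_rsqrt real_sqrt_less_iff real_sqrt_unique zero_le_dist)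
    then have "q y \<le> c" by (simp add: dist)
    then show ?thesis by (simp add: b_def e(2,3) exp_minus)
  qed
  moreover have "b y = 0" if "y \<notin> cball x R" for y
  proof -
    have "R\<^sup>2 < (dist x y)\<^sup>2"
      using that R by (intro power_strict_mono) auto
    then have "q y - c \<ge> c"
      by (simp add: dist c_def)
    then have "e c \<le> e (q y - c)" using e(5) c by blast
    then have "1 + (- 1 / e c) *\<^sub>R e (q y + (- c)) \<le> 0"
      using e(4)[OF c] by (simp add: divide_simps)
    then show ?thesis by (simp add: b_def e(2))
  qed
  ultimately show ?thesis
    using b R c by (intro exI[of _ b] exI[of _ "sqrt c"] exI[of _ R]) auto
qed

subsection \<open>Charts and smooth maps\<close>

context
  fixes A :: "('a::topological_space, 'e::euclidean_space) chart set"
  assumes A: "smooth_atlas A"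
begin

lemma chart_at_in: "chart_at A p \<in> A" and in_chart_at: "p \<in> fst (chart_at A p)"
proof -
  have "\<exists>c. c \<in> A \<and> p \<in> fst c"
    using A unfolding smooth_atlas_def by blast
  then have "chart_at A p \<in> A \<and> p \<in> fst (chart_at A p)"
    unfolding chart_at_def by (rule someI_ex)
  then show "chart_at A p \<in> A" "p \<in> fst (chart_at A p)" by auto
qed

lemma chart_homeomorphism:
  "c \<in> A \<Longrightarrow> homeomorphism (fst c) (snd c ` fst c) (snd c) (chart_inv c)"
  and open_chart_dom: "c \<in> A \<Longrightarrow> open (fst c)"
  and open_chart_range: "c \<in> A \<Longrightarrow> open (snd c ` fst c)"
  and smooth_on_transition: "c \<in> A \<Longrightarrow> d \<in> A \<Longrightarrow>
    smooth_on (snd c ` (fst c \<inter> fst d)) (snd d \<circ> chart_inv c)"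
  using A unfolding smooth_atlas_def by blast+

lemma chart_inv_chart [simp]: "c \<in> A \<Longrightarrow> p \<in> fst c \<Longrightarrow> chart_inv c (snd c p) = p"
  using chart_homeomorphism homeomorphism_apply1 by blast

lemma open_chart_image:
  assumes "c \<in> A" "open U"
  shows "open (snd c ` (fst c \<inter> U))"
proof -
  have "openin (top_of_set (snd c ` fst c)) (snd c ` (fst c \<inter> U))"
    by (rule homeomorphism_imp_open_map[OF chart_homeomorphism[OF assms(1)]])
      (simp add: assms openin_open_Int)
  then show ?thesis
    using open_chart_range[OF assms(1)] openin_open_trans by blast
qed

lemma smooth_map_id: "smooth_map A A (\<lambda>p. p)"
  unfolding smooth_map_def using smooth_on_transition
  by (auto simp: o_def)

end

text \<open>The differential of \<open>f\<close> in two arbitrary charts. \<open>tangent_map\<close>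
  is the case of the selected charts and \<open>chart_change\<close> the case of the identity map,
  so one chain rule serves both and all mixed forms.\<close>

definition local_deriv ::
    "('b, 'f::euclidean_space) chart \<Rightarrow> ('a, 'e::euclidean_space) chart \<Rightarrow>
     ('b \<Rightarrow> 'a) \<Rightarrow> 'b \<Rightarrow> 'f \<Rightarrow> 'e" where
  "local_deriv c d f p = frechet_derivative (snd d \<circ> f \<circ> chart_inv c) (at (snd c p))"

lemma chart_change_eq_local_deriv: "chart_change c d p = local_deriv c d (\<lambda>q. q) p"
  by (simp add: chart_change_def local_deriv_def o_def)

lemma tangent_map_eq_local_deriv:
  "tangent_map B A f p = local_deriv (chart_at B p) (chart_at A (f p)) f p"
  by (simp add: tangent_map_def local_deriv_def)

lemma smooth_map_smooth_on:
  assumes "smooth_map B A f" "c \<in> B" "d \<in> A"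
  shows "smooth_on (snd c ` (fst c \<inter> f -` fst d)) (snd d \<circ> f \<circ> chart_inv c)"
  using assms unfolding smooth_map_def by blast

lemma open_smooth_map_dom:
  assumes "smooth_atlas B" "smooth_atlas A" "smooth_map B A f" "c \<in> B" "d \<in> A"
  shows "open (fst c \<inter> f -` fst d)" and "open (snd c ` (fst c \<inter> f -` fst d))"
proof -
  have "open (f -` fst d)"
    using assms open_chart_dom by (metis continuous_on_open_vimage open_UNIV smooth_map_def inf_top_right)
  then show "open (fst c \<inter> f -` fst d)" "open (snd c ` (fst c \<inter> f -` fst d))"
    using assms open_chart_image open_chart_dom by blast+
qed

lemma local_deriv_has_derivative:
  assumes "smooth_map B A f" "c \<in> B" "d \<in> A" "p \<in> fst c" "f p \<in> fst d"
  shows "(snd d \<circ> f \<circ> chart_inv c has_derivative local_deriv c d f p) (at (snd c p))"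
  unfolding local_deriv_def
  by (rule smooth_on_has_derivative[OF smooth_map_smooth_on[OF assms(1-3)]]) (use assms in auto)

lemma linear_local_deriv:
  assumes "smooth_map B A f" "c \<in> B" "d \<in> A" "p \<in> fst c" "f p \<in> fst d"
  shows "linear (local_deriv c d f p)"
  using local_deriv_has_derivative[OF assms] by (rule has_derivative_linear)

text \<open>The coordinate expression of the composition factors through the middle chart near
  \<open>p\<close>, which is enough for the derivative. Taking one of the two maps to be the
  identity gives the transformation rules for a change of source or target chart.\<close>

lemma local_deriv_compose:
  assumes "smooth_atlas B'" "smooth_atlas B" "smooth_map B' B u" "smooth_map B A f"
    and "c \<in> B'" "d \<in> B" "e \<in> A" "p \<in> fst c" "u p \<in> fst d" "f (u p) \<in> fst e"
  shows "local_deriv c e (\<lambda>q. f (u q)) p v = local_deriv d e f (u p) (local_deriv c d u p v)"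
proof -
  have p: "snd c p \<in> snd c ` (fst c \<inter> u -` fst d)" using assms by auto
  have u: "(snd d \<circ> u \<circ> chart_inv c has_derivative local_deriv c d u p) (at (snd c p))"
    using assms by (intro local_deriv_has_derivative)
  have "(snd d \<circ> u \<circ> chart_inv c) (snd c p) = snd d (u p)"
    using assms by simp
  then have "((snd e \<circ> f \<circ> chart_inv d) has_derivative local_deriv d e f (u p))
      (at ((snd d \<circ> u \<circ> chart_inv c) (snd c p)))"
    using assms by (simp add: local_deriv_has_derivative)
  from has_derivative_compose[OF u this]
  have "((\<lambda>x. (snd e \<circ> f \<circ> chart_inv d) ((snd d \<circ> u \<circ> chart_inv c) x)) has_derivative
      (\<lambda>v. local_deriv d e f (u p) (local_deriv c d u p v))) (at (snd c p))" .
  then have "((snd e \<circ> (\<lambda>q. f (u q)) \<circ> chart_inv c) has_derivative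
      (\<lambda>v. local_deriv d e f (u p) (local_deriv c d u p v))) (at (snd c p))"
    using open_smooth_map_dom(2)[OF assms(1,2,3,5,6)] p
    by (rule has_derivative_transform_within_open) (use assms in auto)
  then show ?thesis
    unfolding local_deriv_def[of c e] by (simp add: frechet_derivative_eqI)
qed

lemma smooth_map_compose:
  assumes "smooth_atlas B'" "smooth_atlas B" "smooth_atlas A" "smooth_map B' B u" "smooth_map B A f"
  shows "smooth_map B' A (\<lambda>q. f (u q))"
  unfolding smooth_map_def
proof (intro conjI ballI)
  show "continuous_on UNIV (\<lambda>q. f (u q))"
    using assms(4,5) unfolding smooth_map_def by (auto intro: continuous_on_compose2)
  fix c e assume c: "c \<in> B'" and e: "e \<in> A"
  show "smooth_on (snd c ` (fst c \<inter> (\<lambda>q. f (u q)) -` fst e)) (snd e \<circ> (\<lambda>q. f (u q)) \<circ> chart_inv c)"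
  proof (rule smooth_on_locally)
    fix x assume "x \<in> snd c ` (fst c \<inter> (\<lambda>q. f (u q)) -` fst e)"
    then obtain p where p: "p \<in> fst c" "f (u p) \<in> fst e" "x = snd c p" by auto
    define d where "d = chart_at B (u p)"
    have d: "d \<in> B" "u p \<in> fst d"
      using chart_at_in in_chart_at assms(2) by (auto simp: d_def)
    define U where "U = u -` (fst d \<inter> f -` fst e)"
    have "open U"
      unfolding U_def using open_smooth_map_dom(1)[OF assms(2,3,5) d(1) e] assms(4)
      by (metis continuous_on_open_vimage open_UNIV smooth_map_def inf_top_right)
    then have op: "open (snd c ` (fst c \<inter> U))"
      using open_chart_image assms(1) c by blast
    have "smooth_on (snd c ` (fst c \<inter> U)) (\<lambda>x. (snd e \<circ> f \<circ> chart_inv d) ((snd d \<circ> u \<circ> chart_inv c) x))"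
    proof (rule smooth_on_compose[OF op open_smooth_map_dom(2)[OF assms(2,3,5) d(1) e]])
      show "(snd d \<circ> u \<circ> chart_inv c) ` snd c ` (fst c \<inter> U) \<subseteq> snd d ` (fst d \<inter> f -` fst e)"
        using assms(1) c by (auto simp: U_def)
      show "smooth_on (snd c ` (fst c \<inter> U)) (snd d \<circ> u \<circ> chart_inv c)"
        by (rule smooth_on_subset[OF smooth_map_smooth_on[OF assms(4) c d(1)]
              open_smooth_map_dom(2)[OF assms(1,2,4) c d(1)]]) (auto simp: U_def)
      show "smooth_on (snd d ` (fst d \<inter> f -` fst e)) (snd e \<circ> f \<circ> chart_inv d)"
        by (rule smooth_map_smooth_on[OF assms(5) d(1) e])
    qed
    then have "smooth_on (snd c ` (fst c \<inter> U)) (snd e \<circ> (\<lambda>q. f (u q)) \<circ> chart_inv c)"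
      by (rule smooth_on_cong[OF op, rotated]) (use assms(1,2) c d in \<open>auto simp: U_def\<close>)
    then show "\<exists>U. open U \<and> x \<in> U \<and> smooth_on U (snd e \<circ> (\<lambda>q. f (u q)) \<circ> chart_inv c)"
      using op p d by (intro exI[of _ "snd c ` (fst c \<inter> U)"]) (auto simp: U_def)
  qed
qed

lemma chart_change_self:
  assumes "smooth_atlas A" "c \<in> A" "p \<in> fst c"
  shows "chart_change c c p v = v"
proof -
  have "((\<lambda>x. x) has_derivative (\<lambda>v. v)) (at (snd c p))" by (rule has_derivative_ident)
  then have "(snd c \<circ> chart_inv c has_derivative (\<lambda>v. v)) (at (snd c p))"
    using open_chart_range[OF assms(1,2)] imageI[OF assms(3)]
    by (rule has_derivative_transform_within_open) (use assms in auto)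
  then show ?thesis
    unfolding chart_change_def by (simp add: frechet_derivative_eqI)
qed

lemma chart_change_local_deriv:
  assumes "smooth_atlas B" "smooth_atlas A" "smooth_map B A f"
    and "c \<in> B" "d \<in> A" "d' \<in> A" "p \<in> fst c" "f p \<in> fst d" "f p \<in> fst d'"
  shows "chart_change d d' (f p) (local_deriv c d f p v) = local_deriv c d' f p v"
  using local_deriv_compose[OF assms(1-3) smooth_map_id[OF assms(2)], of c d d' p v] assms
  by (simp add: chart_change_eq_local_deriv)

lemma local_deriv_chart_change:
  assumes "smooth_atlas B" "smooth_atlas A" "smooth_map B A f"
    and "c \<in> B" "c' \<in> B" "d \<in> A" "p \<in> fst c" "p \<in> fst c'" "f p \<in> fst d"
  shows "local_deriv c' d f p (chart_change c c' p v) = local_deriv c d f p v"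
  using local_deriv_compose[OF assms(1) assms(1) smooth_map_id[OF assms(1)] assms(3), of c c' d p v] assms
  by (simp add: chart_change_eq_local_deriv)

lemma chart_change_chart_change:
  assumes "smooth_atlas A" "c \<in> A" "d \<in> A" "e \<in> A" "p \<in> fst c" "p \<in> fst d" "p \<in> fst e"
  shows "chart_change d e p (chart_change c d p v) = chart_change c e p v"
  using chart_change_local_deriv[OF assms(1,1) smooth_map_id[OF assms(1)], of c d e p v] assms
  by (simp add: chart_change_eq_local_deriv)

lemma chart_change_inverse:
  assumes "smooth_atlas A" "c \<in> A" "d \<in> A" "p \<in> fst c" "p \<in> fst d"
  shows "chart_change d c p (chart_change c d p v) = v"
  using chart_change_chart_change[of A c d c p v] chart_change_self[of A c p v] assms by simp

lemma linear_chart_change: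
  assumes "smooth_atlas A" "c \<in> A" "d \<in> A" "p \<in> fst c" "p \<in> fst d"
  shows "linear (chart_change c d p)"
  unfolding chart_change_eq_local_deriv
  using assms by (intro linear_local_deriv[OF smooth_map_id]) auto

lemma field_rep_at:
  assumes "smooth_atlas B" "c \<in> B" "p \<in> fst c"
  shows "field_rep A f c d V (snd c p) = chart_change (chart_at A (f p)) d (f p) (V p)"
  using assms by (simp add: field_rep_def)

lemma field_rep_coord_field:
  assumes "smooth_atlas A" "c \<in> A" "c' \<in> A" "d \<in> A" "p \<in> fst c" "p \<in> fst c'" "p \<in> fst d"
  shows "field_rep A (\<lambda>p. p) c' d (coord_field A c v) (snd c' p) = chart_change c d p v"
  using assms chart_change_chart_change[of A c "chart_at A p" d p v]
  by (simp add: field_rep_at[of A] coord_field_def chart_at_in in_chart_at)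

lemma coord_field_field_rep:
  assumes "smooth_atlas B" "smooth_atlas A" "c \<in> B" "a \<in> A" "p \<in> fst c" "f p \<in> fst a"
  shows "coord_field A a (field_rep A f c a V (snd c p)) (f p) = V p"
  using assms by (simp add: field_rep_at coord_field_def chart_change_inverse chart_at_in in_chart_at)

subsection \<open>Extension of coordinate fields\<close>

text \<open>Multiplying by a bump function: this is where the Hausdorff property is used, so that the
  support, compact in the chart domain, is closed in the manifold.\<close>

lemma coord_field_extension:
  fixes A :: "('a::t2_space, 'e::euclidean_space) chart set"
  assumes A: "smooth_atlas A" and c: "c \<in> A" and p: "p \<in> fst c"
  shows "\<exists>X U. smooth_field A X \<and> open U \<and> p \<in> U \<and> U \<subseteq> fst c \<and> (\<forall>q\<in>U. X q = coord_field A c v q)"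
proof -
  obtain b r R where b: "smooth_on UNIV b" "0 < r" "cball (snd c p) R \<subseteq> snd c ` fst c"
    "\<And>y. y \<in> ball (snd c p) r \<Longrightarrow> b y = 1" "\<And>y. y \<notin> cball (snd c p) R \<Longrightarrow> b y = (0::real)"
    using smooth_bump[OF open_chart_range[OF A c] imageI[OF p]] by metis
  define X where "X q = (if q \<in> fst c then b (snd c q) *\<^sub>R coord_field A c v q else 0)" for q
  define Q where "Q = chart_inv c ` cball (snd c p) R"
  have "continuous_on (snd c ` fst c) (chart_inv c)"
    using chart_homeomorphism[OF A c] by (rule homeomorphism_cont2)
  then have "compact Q"
    unfolding Q_def using b(3) by (intro compact_continuous_image compact_cball) (rule continuous_on_subset)
  then have "closed Q" by (rule compact_imp_closed)
  have X0: "X q = 0" if "q \<notin> Q" for q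
  proof (cases "q \<in> fst c")
    case True
    then have "snd c q \<notin> cball (snd c p) R"
      using that A c unfolding Q_def by (metis chart_inv_chart imageI)
    then show ?thesis by (simp add: X_def b(5))
  qed (simp add: X_def)
  have QC: "Q \<subseteq> fst c"
    using b(3) A c by (auto simp: Q_def)
  have "smooth_field A X"
    unfolding smooth_field_def smooth_field_along_def
  proof (intro ballI)
    fix c' d assume c': "c' \<in> A" and d: "d \<in> A"
    show "smooth_on (snd c' ` (fst c' \<inter> UNIV \<inter> (\<lambda>p. p) -` fst d)) (field_rep A (\<lambda>p. p) c' d X)"
    proof (rule smooth_on_locally)
      fix x assume "x \<in> snd c' ` (fst c' \<inter> UNIV \<inter> (\<lambda>p. p) -` fst d)"
      then obtain q where q: "q \<in> fst c'" "q \<in> fst d" "x = snd c' q" by auto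
      show "\<exists>U. open U \<and> x \<in> U \<and> smooth_on U (field_rep A (\<lambda>p. p) c' d X)"
      proof (cases "q \<in> fst c")
        case True
        define U where "U = snd c' ` (fst c' \<inter> (fst c \<inter> fst d))"
        have U: "open U"
          unfolding U_def using A c c' d
          by (intro open_chart_image open_Int open_chart_dom) auto
        have tr: "smooth_on U (snd c \<circ> chart_inv c')"
          by (rule smooth_on_subset[OF smooth_on_transition[OF A c' c]
                open_chart_image[OF A c' open_chart_dom[OF A c]]]) (auto simp: U_def)
        have "smooth_on U (\<lambda>x. frechet_derivative (snd d \<circ> chart_inv c) (at ((snd c \<circ> chart_inv c') x)) v)"
          by (rule smooth_on_compose[OF U open_chart_image[OF A c open_chart_dom[OF A d]] _ tr
                smooth_on_frechet_derivative[OF smooth_on_transition[OF A c d]]])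
            (use A c c' in \<open>auto simp: U_def\<close>)
        moreover have "smooth_on U (\<lambda>x. b ((snd c \<circ> chart_inv c') x))"
          by (rule smooth_on_compose[OF U open_UNIV _ tr b(1)]) simp
        ultimately have "smooth_on U (\<lambda>x. b ((snd c \<circ> chart_inv c') x) *\<^sub>R
            frechet_derivative (snd d \<circ> chart_inv c) (at ((snd c \<circ> chart_inv c') x)) v)"
          using smooth_on_scaleR[OF U] by blast
        then have "smooth_on U (field_rep A (\<lambda>p. p) c' d X)"
        proof (rule smooth_on_cong[OF U, rotated])
          fix x assume "x \<in> U"
          then obtain q where q: "q \<in> fst c'" "q \<in> fst c" "q \<in> fst d" "x = snd c' q"
            by (auto simp: U_def)
          have "chart_change (chart_at A q) d q (X q) =
              b (snd c q) *\<^sub>R chart_change (chart_at A q) d q (coord_field A c v q)"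
            using q A d by (simp add: X_def linear_scale[OF linear_chart_change[OF A]] chart_at_in in_chart_at)
          also have "\<dots> = b (snd c q) *\<^sub>R chart_change c d q v"
            using field_rep_coord_field[OF A c c' d q(2) q(1) q(3)] q A c' by (simp add: field_rep_at[of A])
          finally show "b ((snd c \<circ> chart_inv c') x) *\<^sub>R
              frechet_derivative (snd d \<circ> chart_inv c) (at ((snd c \<circ> chart_inv c') x)) v =
              field_rep A (\<lambda>p. p) c' d X x"
            using q A c' by (simp add: field_rep_at[of A] chart_change_def)
        qed
        then show ?thesis
          using U q True by (auto simp: U_def)
      next
        case False
        \<comment> \<open>Off the chart domain the point lies in the complement of \<open>Q\<close>,
          which is open because \<open>Q\<close> is closed, and \<open>X\<close> vanishes there
          identically.\<close>
        define U where "U = snd c' ` (fst c' \<inter> (- Q \<inter> fst d))"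
        have U: "open U"
          unfolding U_def using A c' d \<open>closed Q\<close>
          by (intro open_chart_image open_Int open_chart_dom) auto
        have "smooth_on U (\<lambda>x. 0 :: 'e)" by (rule smooth_on_const[OF U])
        then have "smooth_on U (field_rep A (\<lambda>p. p) c' d X)"
        proof (rule smooth_on_cong[OF U, rotated])
          fix x assume "x \<in> U"
          then obtain q where q: "q \<in> fst c'" "q \<notin> Q" "q \<in> fst d" "x = snd c' q"
            by (auto simp: U_def)
          then show "0 = field_rep A (\<lambda>p. p) c' d X x"
            using A c' d by (simp add: field_rep_at[of A] X0
                linear_0[OF linear_chart_change[OF A]] chart_at_in in_chart_at)
        qed
        then show ?thesis
          using U q False QC by (auto simp: U_def)
      qed
    qed
  qed
  moreover define U where "U = fst c \<inter> snd c -` ball (snd c p) r"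
  moreover have "open U"
    unfolding U_def using homeomorphism_cont1[OF chart_homeomorphism[OF A c]] open_chart_dom[OF A c]
    by (rule continuous_open_preimage) simp
  moreover have "X q = coord_field A c v q" if "q \<in> U" for q
    using that b(4)[of "snd c q"] by (simp add: X_def U_def)
  ultimately show ?thesis
    using b(2) p by (intro exI[of _ X] exI[of _ U]) auto
qed

subsection \<open>The Levi-Civita connection at a point\<close>

text \<open>\<open>frechet_derivative\<close> selects from the set of all derivatives at
  \<open>x\<close>, and for functions that agree near \<open>x\<close> these sets coincide; thus the
  equation holds even where neither function is differentiable.\<close>

lemma frechet_derivative_cong_open:
  assumes "open S" "x \<in> S" "\<And>y. y \<in> S \<Longrightarrow> F y = G y"
  shows "frechet_derivative F (at x) = frechet_derivative G (at x)"
proof -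
  have "(F has_derivative F') (at x) = (G has_derivative F') (at x)" for F'
    using has_derivative_transform_within_open[OF _ assms(1,2)] assms(3) by metis
  then show ?thesis by (simp add: frechet_derivative_def)
qed

lemma field_rep_cong:
  assumes "smooth_atlas B" "c \<in> B" "open U" "p \<in> U" "p \<in> fst c"
    and "\<And>q. q \<in> U \<Longrightarrow> V q = W q"
  shows "frechet_derivative (field_rep A f c d V) (at (snd c p)) =
    frechet_derivative (field_rep A f c d W) (at (snd c p))"
proof (rule frechet_derivative_cong_open)
  show "open (snd c ` (fst c \<inter> U))"
    using assms by (intro open_chart_image)
  show "field_rep A f c d V y = field_rep A f c d W y" if "y \<in> snd c ` (fst c \<inter> U)" for y
    using that assms by (auto simp: field_rep_at)
qed (use assms in auto)

lemma tangent_map_ident: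
  assumes "smooth_atlas A"
  shows "tangent_map A A (\<lambda>q. q) p v = v"
  using chart_change_self[OF assms chart_at_in[OF assms] in_chart_at[OF assms], of p v]
  by (simp add: tangent_map_eq_local_deriv chart_change_eq_local_deriv)

lemma coord_field_chart_at:
  assumes "smooth_atlas A"
  shows "coord_field A (chart_at A p) v p = v"
  using chart_change_self[OF assms chart_at_in[OF assms] in_chart_at[OF assms], of p v]
  by (simp add: coord_field_def)

text \<open>In its own chart a coordinate field has constant components. So at \<open>p\<close> the
  covariant derivative of such a field reduces to the term with the bilinear map
  \<open>C p\<close>.\<close>

lemma frechet_derivative_coord_field:
  assumes A: "smooth_atlas A" and U: "open U" "p \<in> U"
    and X: "\<And>q. q \<in> U \<Longrightarrow> X q = coord_field A (chart_at A p) v q"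
  shows "frechet_derivative (field_rep A (\<lambda>q. q) (chart_at A p) (chart_at A p) X)
    (at (snd (chart_at A p) p)) w = 0"
proof -
  define a where "a = chart_at A p"
  have a: "a \<in> A" "p \<in> fst a" using A by (auto simp: a_def chart_at_in in_chart_at)
  have "frechet_derivative (field_rep A (\<lambda>q. q) a a X) (at (snd a p)) =
      frechet_derivative (field_rep A (\<lambda>q. q) a a (coord_field A a v)) (at (snd a p))"
    using X by (intro field_rep_cong[OF A a(1) U a(2)]) (simp add: a_def)
  also have "\<dots> = frechet_derivative (\<lambda>x. v) (at (snd a p))"
    by (rule frechet_derivative_cong_open[OF open_chart_range[OF A a(1)] imageI[OF a(2)]])
      (use A a in \<open>auto simp: field_rep_coord_field chart_change_self\<close>)
  finally show ?thesis by (simp add: a_def)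
qed

lemma coord_field_extension_at:
  fixes A :: "('a::t2_space, 'e::euclidean_space) chart set"
  assumes "smooth_atlas A"
  obtains X U where "smooth_field A X" "open U" "p \<in> U" "U \<subseteq> fst (chart_at A p)"
    "\<And>q. q \<in> U \<Longrightarrow> X q = coord_field A (chart_at A p) v q" "X p = v"
proof -
  obtain X U where X: "smooth_field A X" "open U" "p \<in> U" "U \<subseteq> fst (chart_at A p)"
    "\<forall>q\<in>U. X q = coord_field A (chart_at A p) v q"
    using coord_field_extension[OF assms chart_at_in[OF assms] in_chart_at[OF assms]] by metis
  have "X p = v"
    using bspec[OF X(5,3)] coord_field_chart_at[OF assms] by metis
  show ?thesis
    by (rule that[OF X(1-4) bspec[OF X(5)] \<open>X p = v\<close>])
qed

text \<open>The hypotheses on \<open>C\<close>, \<open>g\<close> and \<open>J\<close> are given for global smooth fields; inserting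
  extensions of coordinate fields turns them into identities for the Christoffel symbols.\<close>

lemma christoffel_symmetric:
  fixes A :: "('a::t2_space, 'e::euclidean_space) chart set"
  assumes A: "smooth_atlas A" and lc: "levi_civita A g C"
  shows "C p v w = C p w v"
proof -
  obtain X U where X: "smooth_field A X" "open U" "p \<in> U" "U \<subseteq> fst (chart_at A p)"
    "\<And>q. q \<in> U \<Longrightarrow> X q = coord_field A (chart_at A p) v q" "X p = v"
    using coord_field_extension_at[OF A] by blast
  obtain Y U' where Y: "smooth_field A Y" "open U'" "p \<in> U'" "U' \<subseteq> fst (chart_at A p)"
    "\<And>q. q \<in> U' \<Longrightarrow> Y q = coord_field A (chart_at A p) w q" "Y p = w"
    using coord_field_extension_at[OF A] by blast
  note D = frechet_derivative_coord_field[OF A X(2,3) X(5)] frechet_derivative_coord_field[OF A Y(2,3) Y(5)]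
  have "ambient_deriv A C X Y p - ambient_deriv A C Y X p = lie_bracket A X Y p"
    using lc X(1) Y(1) unfolding levi_civita_def by blast
  then show ?thesis
    by (simp add: cov_deriv_def lie_bracket_def Let_def D tangent_map_ident[OF A] X(6) Y(6))
qed

definition metric_rep ::
    "('a, 'e::euclidean_space) chart set \<Rightarrow> ('a, 'e) chart \<Rightarrow> ('a \<Rightarrow> 'e \<Rightarrow> 'e \<Rightarrow> real) \<Rightarrow>
     'e \<Rightarrow> 'e \<Rightarrow> 'e \<Rightarrow> real" where
  "metric_rep A c g y v w =
     g (chart_inv c y) (coord_field A c v (chart_inv c y)) (coord_field A c w (chart_inv c y))"

text \<open>Metric compatibility for fields whose components are constant near \<open>p\<close>. It
  is stated at \<open>p\<close> alone because \<open>C p\<close> refers to the chart selected at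
  \<open>p\<close>; at a neighbouring point the selected chart may be another one.\<close>

lemma metric_rep_has_derivative:
  fixes A :: "('a::t2_space, 'e::euclidean_space) chart set" and p :: 'a
  assumes A: "smooth_atlas A" and g: "semi_riemannian_metric A g r" and lc: "levi_civita A g C"
  defines "a \<equiv> chart_at A p"
  shows "((\<lambda>y. metric_rep A a g y v w) has_derivative
    (\<lambda>h. g p (C p h v) w + g p v (C p h w))) (at (snd a p))"
proof -
  have a: "a \<in> A" "p \<in> fst a" using A by (auto simp: a_def chart_at_in in_chart_at)
  obtain X U where X: "smooth_field A X" "open U" "p \<in> U" "U \<subseteq> fst a"
    "\<And>q. q \<in> U \<Longrightarrow> X q = coord_field A a v q" "X p = v"
    using coord_field_extension_at[OF A, of p v, folded a_def] by blast
  obtain Y U' where Y: "smooth_field A Y" "open U'" "p \<in> U'" "U' \<subseteq> fst a"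
    "\<And>q. q \<in> U' \<Longrightarrow> Y q = coord_field A a w q" "Y p = w"
    using coord_field_extension_at[OF A, of p w, folded a_def] by blast
  note DX = frechet_derivative_coord_field[OF A X(2,3) X(5)[unfolded a_def], folded a_def]
  note DY = frechet_derivative_coord_field[OF A Y(2,3) Y(5)[unfolded a_def], folded a_def]
  have eq: "(\<lambda>y. metric_rep A a g y v w) =
      (\<lambda>p. g p (coord_field A a v p) (coord_field A a w p)) \<circ> chart_inv a"
    by (auto simp: metric_rep_def)
  have sm: "smooth_on (snd a ` fst a) (\<lambda>y. metric_rep A a g y v w)"
    unfolding eq using g a(1) by (simp add: semi_riemannian_metric_def)
  have "frechet_derivative (\<lambda>y. metric_rep A a g y v w) (at (snd a p)) h =
      g p (C p h v) w + g p v (C p h w)" for h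
  proof -
    obtain Z where Z: "smooth_field A Z" "Z p = h"
      using coord_field_extension_at[OF A, of p h] by blast
    have "dir_deriv A (\<lambda>p. g p (X p) (Y p)) p (Z p) =
        g p (ambient_deriv A C Z X p) (Y p) + g p (X p) (ambient_deriv A C Z Y p)"
      using lc Z(1) X(1) Y(1) unfolding levi_civita_def by blast
    moreover have "frechet_derivative ((\<lambda>p. g p (X p) (Y p)) \<circ> chart_inv a) (at (snd a p)) =
        frechet_derivative (\<lambda>y. metric_rep A a g y v w) (at (snd a p))"
      by (rule frechet_derivative_cong_open[OF open_chart_image[OF A a(1) open_Int[OF X(2) Y(2)]]])
        (use A a X(3,5) Y(3,5) in \<open>auto simp: metric_rep_def\<close>)
    ultimately show ?thesis
      by (simp add: cov_deriv_def dir_deriv_def DX DY X(6) Y(6) Z(2) tangent_map_ident[OF A] flip: a_def)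
  qed
  then have eq': "frechet_derivative (\<lambda>y. metric_rep A a g y v w) (at (snd a p)) =
      (\<lambda>h. g p (C p h v) w + g p v (C p h w))" by (rule ext)
  show ?thesis
    using smooth_on_has_derivative[OF sm imageI[OF a(2)]] unfolding eq' .
qed

definition structure_rep ::
    "('a, 'e::euclidean_space) chart set \<Rightarrow> ('a, 'e) chart \<Rightarrow> ('a \<Rightarrow> 'e \<Rightarrow> 'e) \<Rightarrow> 'e \<Rightarrow> 'e \<Rightarrow> 'e" where
  "structure_rep A c J y v = field_rep A (\<lambda>q. q) c c (\<lambda>q. J q (coord_field A c v q)) y"

text \<open>Parallelism of \<open>J\<close> on a field with constant components \<open>v\<close>:
  the derivative of the components of \<open>J v\<close> plus \<open>C p h (J p v)\<close> must
  equal \<open>J p (C p h v)\<close>.\<close>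

lemma structure_rep_has_derivative:
  fixes A :: "('a::t2_space, 'e::euclidean_space) chart set" and p :: 'a
  assumes K: "indefinite_kaehler A J g C"
  defines "a \<equiv> chart_at A p"
  shows "((\<lambda>y. structure_rep A a J y v) has_derivative
    (\<lambda>h. J p (C p h v) - C p h (J p v))) (at (snd a p))"
proof -
  have A: "smooth_atlas A" and acs: "almost_complex_structure A J"
    using K by (auto simp: indefinite_kaehler_def)
  have a: "a \<in> A" "p \<in> fst a" using A by (auto simp: a_def chart_at_in in_chart_at)
  obtain X U where X: "smooth_field A X" "open U" "p \<in> U" "U \<subseteq> fst a"
    "\<And>q. q \<in> U \<Longrightarrow> X q = coord_field A a v q" "X p = v"
    using coord_field_extension_at[OF A, of p v, folded a_def] by blast
  note DX = frechet_derivative_coord_field[OF A X(2,3) X(5)[unfolded a_def], folded a_def]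
  have eq: "(\<lambda>y. structure_rep A a J y v) =
      field_rep A (\<lambda>q. q) a a (\<lambda>q. J q (coord_field A a v q))"
    by (auto simp: structure_rep_def)
  have sm: "smooth_on (snd a ` fst a) (\<lambda>y. structure_rep A a J y v)"
    unfolding eq using acs a(1) by (simp add: almost_complex_structure_def)
  have "frechet_derivative (\<lambda>y. structure_rep A a J y v) (at (snd a p)) h =
      J p (C p h v) - C p h (J p v)" for h
  proof -
    obtain Z where Z: "smooth_field A Z" "Z p = h"
      using coord_field_extension_at[OF A, of p h] by blast
    have "ambient_deriv A C Z (\<lambda>q. J q (X q)) p - J p (ambient_deriv A C Z X p) = 0"
      using K Z(1) X(1) unfolding indefinite_kaehler_def by blast
    moreover have "frechet_derivative (field_rep A (\<lambda>q. q) a a (\<lambda>q. J q (X q))) (at (snd a p)) =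
        frechet_derivative (\<lambda>y. structure_rep A a J y v) (at (snd a p))"
      unfolding eq by (rule field_rep_cong[OF A a(1) X(2,3) a(2)]) (simp add: X(5))
    ultimately show ?thesis
      by (simp add: cov_deriv_def DX X(6) Z(2) tangent_map_ident[OF A] algebra_simps flip: a_def)
  qed
  then have eq': "frechet_derivative (\<lambda>y. structure_rep A a J y v) (at (snd a p)) =
      (\<lambda>h. J p (C p h v) - C p h (J p v))" by (rule ext)
  show ?thesis
    using smooth_on_has_derivative[OF sm imageI[OF a(2)]] unfolding eq' .
qed

text \<open>Product rule for a moving linear map applied to a moving vector. The derivative of the
  map is available only on each fixed vector; in basis coordinates the expression is a finite sum of
  products, and linearity of \<open>L'\<close> in its first argument reassembles the result.\<close>

lemma has_derivative_linear_family:
  fixes L :: "'e::real_normed_vector \<Rightarrow> 'd::euclidean_space \<Rightarrow> 'v::real_normed_vector"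
  assumes S: "open S" "x \<in> S" and lin: "\<And>y. y \<in> S \<Longrightarrow> linear (L y)"
    and L: "\<And>v. ((\<lambda>y. L y v) has_derivative L' v) (at x)"
    and lin': "\<And>h. linear (\<lambda>v. L' v h)"
    and V: "(V has_derivative V') (at x)"
  shows "((\<lambda>y. L y (V y)) has_derivative (\<lambda>h. L' (V x) h + L x (V' h))) (at x)"
proof -
  have "((\<lambda>y. \<Sum>i\<in>Basis. (V y \<bullet> i) *\<^sub>R L y i) has_derivative
      (\<lambda>h. \<Sum>i\<in>Basis. (V x \<bullet> i) *\<^sub>R L' i h + (V' h \<bullet> i) *\<^sub>R L x i)) (at x)"
    by (intro has_derivative_sum has_derivative_scaleR L has_derivative_inner_left V)
  moreover have "(\<Sum>i\<in>Basis. (V x \<bullet> i) *\<^sub>R L' i h + (V' h \<bullet> i) *\<^sub>R L x i) = L' (V x) h + L x (V' h)" for h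
    using linear_euclidean_expand[OF lin', of "V x" h] linear_euclidean_expand[OF lin[OF S(2)], of "V' h"]
    by (simp add: sum.distrib)
  ultimately have "((\<lambda>y. \<Sum>i\<in>Basis. (V y \<bullet> i) *\<^sub>R L y i) has_derivative
      (\<lambda>h. L' (V x) h + L x (V' h))) (at x)" by simp
  then show ?thesis
    using S by (rule has_derivative_transform_within_open) (simp add: linear_euclidean_expand[OF lin, symmetric])
qed

subsection \<open>Derivatives along an immersion\<close>

text \<open>\<open>push\<close> is built from the selected charts, which may jump from point to
  point. This form with two fixed charts is the one that can be differentiated.\<close>

lemma field_rep_push:
  assumes "smooth_atlas B" "smooth_atlas A" "smooth_map B A f"
    and "c \<in> B" "a \<in> A" "p \<in> fst c" "f p \<in> fst a"
  shows "field_rep A f c a (push B A f Y) (snd c p) =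
    local_deriv c a f p (field_rep B (\<lambda>q. q) c c Y (snd c p))"
proof -
  have b: "chart_at B p \<in> B" "p \<in> fst (chart_at B p)" "chart_at A (f p) \<in> A" "f p \<in> fst (chart_at A (f p))"
    using assms by (simp_all add: chart_at_in in_chart_at)
  have "field_rep A f c a (push B A f Y) (snd c p) = local_deriv (chart_at B p) a f p (Y p)"
    using assms b by (simp add: field_rep_at push_def tangent_map_eq_local_deriv chart_change_local_deriv)
  also have "\<dots> = local_deriv c a f p (chart_change (chart_at B p) c p (Y p))"
    using assms b by (simp add: local_deriv_chart_change)
  finally show ?thesis
    using assms by (simp add: field_rep_at)
qed

lemma local_rep_smooth:
  assumes "smooth_atlas B" "smooth_atlas A" "smooth_map B A f" "c \<in> B" "d \<in> A"
    and "p \<in> fst c" "f p \<in> fst d"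
  obtains S where "open S" "snd c p \<in> S" "S \<subseteq> snd c ` (fst c \<inter> f -` fst d)"
    "smooth_on S (snd d \<circ> f \<circ> chart_inv c)"
    "\<And>x. x \<in> S \<Longrightarrow> chart_inv c x \<in> fst c \<and> f (chart_inv c x) \<in> fst d \<and> snd c (chart_inv c x) = x"
proof
  show "open (snd c ` (fst c \<inter> f -` fst d))"
    using open_smooth_map_dom(2)[OF assms(1-5)] .
  show "smooth_on (snd c ` (fst c \<inter> f -` fst d)) (snd d \<circ> f \<circ> chart_inv c)"
    using smooth_map_smooth_on[OF assms(3-5)] .
qed (use assms in auto)

lemma field_rep_push_has_derivative:
  fixes A :: "('a::topological_space, 'e::euclidean_space) chart set"
    and B :: "('b::topological_space, 'f::euclidean_space) chart set"
  assumes "smooth_atlas B" "smooth_atlas A" "smooth_map B A f" "smooth_field B Y"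
    and "c \<in> B" "a \<in> A" "p \<in> fst c" "f p \<in> fst a"
  defines "\<phi> \<equiv> snd a \<circ> f \<circ> chart_inv c"
  shows "(field_rep A f c a (push B A f Y) has_derivative
      (\<lambda>h. frechet_derivative (\<lambda>x. frechet_derivative \<phi> (at x) (field_rep B (\<lambda>q. q) c c Y (snd c p)))
             (at (snd c p)) h +
           local_deriv c a f p (frechet_derivative (field_rep B (\<lambda>q. q) c c Y) (at (snd c p)) h)))
    (at (snd c p))"
proof -
  define V where "V = field_rep B (\<lambda>q. q) c c Y"
  obtain S where S: "open S" "snd c p \<in> S" "S \<subseteq> snd c ` (fst c \<inter> f -` fst a)" "smooth_on S \<phi>"
    "\<And>x. x \<in> S \<Longrightarrow> chart_inv c x \<in> fst c \<and> f (chart_inv c x) \<in> fst a \<and> snd c (chart_inv c x) = x"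
    unfolding \<phi>_def using local_rep_smooth[OF assms(1-3,5-8)] by metis
  have d\<phi>: "frechet_derivative \<phi> (at (snd c p)) = local_deriv c a f p" for p
    by (simp add: local_deriv_def \<phi>_def)
  have "smooth_on (snd c ` (fst c \<inter> UNIV \<inter> (\<lambda>q. q) -` fst c)) V"
    using assms(4,5) unfolding smooth_field_def smooth_field_along_def V_def by blast
  then have V: "(V has_derivative frechet_derivative V (at (snd c p))) (at (snd c p))"
    by (rule smooth_on_has_derivative) (use assms in auto)
  have lin: "linear (frechet_derivative \<phi> (at y))" if "y \<in> S" for y
    using smooth_on_has_derivative[OF S(4) that] by (rule has_derivative_linear)
  \<comment> \<open>Linearity in \<open>v\<close> is not visible while \<open>v\<close> is the
    direction of the inner derivative; symmetry of second derivatives makes it the direction of the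
    outer one.\<close>
  have lin': "linear (\<lambda>v. frechet_derivative (\<lambda>y. frechet_derivative \<phi> (at y) v) (at (snd c p)) h)" for h
  proof -
    have "frechet_derivative (\<lambda>y. frechet_derivative \<phi> (at y) v) (at (snd c p)) h =
        frechet_derivative (\<lambda>y. frechet_derivative \<phi> (at y) h) (at (snd c p)) v" for v
      using symmetric_second_derivative[OF S(4,1,2)] .
    then show ?thesis
      using has_derivative_linear[OF smooth_on_has_derivative[OF
            smooth_on_frechet_derivative[OF S(4)] S(2)]] by simp
  qed
  have "((\<lambda>y. frechet_derivative \<phi> (at y) (V y)) has_derivative
      (\<lambda>h. frechet_derivative (\<lambda>y. frechet_derivative \<phi> (at y) (V (snd c p))) (at (snd c p)) h +
        frechet_derivative \<phi> (at (snd c p)) (frechet_derivative V (at (snd c p)) h))) (at (snd c p))"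
    by (rule has_derivative_linear_family[OF S(1,2) lin smooth_on_has_derivative[OF
            smooth_on_frechet_derivative[OF S(4)] S(2)] lin' V])
  then have "(field_rep A f c a (push B A f Y) has_derivative
      (\<lambda>h. frechet_derivative (\<lambda>y. frechet_derivative \<phi> (at y) (V (snd c p))) (at (snd c p)) h +
        frechet_derivative \<phi> (at (snd c p)) (frechet_derivative V (at (snd c p)) h))) (at (snd c p))"
    using S(1,2)
  proof (rule has_derivative_transform_within_open)
    fix x assume "x \<in> S"
    then show "frechet_derivative \<phi> (at x) (V x) = field_rep A f c a (push B A f Y) x"
      using field_rep_push[OF assms(1-3,5,6), of "chart_inv c x" Y] S(5)[of x] d\<phi>[of "chart_inv c x"]
      by (simp add: V_def)
  qed
  then show ?thesis by (simp add: V_def d\<phi>)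
qed

text \<open>A field along \<open>f\<close> need not extend to a smooth field of the ambient
  manifold, so compatibility of \<open>C\<close> cannot be applied to it directly. Instead the
  scalar product is written with \<open>metric_rep\<close> at a moving base point, and the product
  rule for linear families is applied in one slot and then in the other.\<close>

lemma cov_deriv_metric_along:
  fixes A :: "('a::t2_space, 'e::euclidean_space) chart set"
    and B :: "('b::t2_space, 'f::euclidean_space) chart set"
  assumes B: "smooth_atlas B" and A: "smooth_atlas A" and g: "semi_riemannian_metric A g r"
    and lc: "levi_civita A g C" and f: "smooth_map B A f"
    and Y: "smooth_field B Y" and Z: "smooth_field B Z"
  shows "dir_deriv B (\<lambda>q. induced_metric B A g f q (Y q) (Z q)) p v =
    g (f p) (cov_deriv A C B f (push B A f Y) p v) (push B A f Z p) +
    g (f p) (push B A f Y p) (cov_deriv A C B f (push B A f Z) p v)"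
proof -
  define b where "b = chart_at B p"
  define a where "a = chart_at A (f p)"
  define \<phi> where "\<phi> = snd a \<circ> f \<circ> chart_inv b"
  define YY where "YY = field_rep A f b a (push B A f Y)"
  define ZZ where "ZZ = field_rep A f b a (push B A f Z)"
  define x where "x = snd b p"
  have b: "b \<in> B" "p \<in> fst b" and a: "a \<in> A" "f p \<in> fst a"
    using A B by (auto simp: a_def b_def chart_at_in in_chart_at)
  obtain S where S: "open S" "x \<in> S" "S \<subseteq> snd b ` (fst b \<inter> f -` fst a)" "smooth_on S \<phi>"
    "\<And>x. x \<in> S \<Longrightarrow> chart_inv b x \<in> fst b \<and> f (chart_inv b x) \<in> fst a \<and> snd b (chart_inv b x) = x"
    unfolding \<phi>_def x_def using local_rep_smooth[OF B A f b(1) a(1) b(2) a(2)] by metis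
  have \<phi>x: "\<phi> x = snd a (f p)" using B b by (simp add: \<phi>_def x_def)
  have d\<phi>: "(\<phi> has_derivative tangent_map B A f p) (at x)"
    unfolding \<phi>_def x_def tangent_map_eq_local_deriv a_def b_def
    by (rule local_deriv_has_derivative[OF f]) (use A B in \<open>auto simp: chart_at_in in_chart_at\<close>)
  obtain Y' where Y': "(YY has_derivative Y') (at x)"
    unfolding YY_def x_def using field_rep_push_has_derivative[OF B A f Y b(1) a(1) b(2) a(2)] by blast
  obtain Z' where Z': "(ZZ has_derivative Z') (at x)"
    unfolding ZZ_def x_def using field_rep_push_has_derivative[OF B A f Z b(1) a(1) b(2) a(2)] by blast
  have Yx: "YY x = push B A f Y p" and Zx: "ZZ x = push B A f Z p"
    using coord_field_field_rep[where f = f, OF B A b(1) a(1) b(2) a(2)] coord_field_chart_at[OF A, of "f p"]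
    unfolding YY_def ZZ_def x_def a_def by metis+
  have bil: "bilinear (g q)" for q
    using g by (simp add: semi_riemannian_metric_def)
  have bilC: "bilinear (C q)" for q
    using lc by (simp add: levi_civita_def affine_connection_def)
  have linc: "linear (\<lambda>v. coord_field A a v q)" if "q \<in> fst a" for q
    unfolding coord_field_def using A a that by (intro linear_chart_change) (auto simp: chart_at_in in_chart_at)
  have inv_a: "chart_inv a (\<phi> y) \<in> fst a" if "y \<in> S" for y
    using S(5)[OF that] A a by (simp add: \<phi>_def)
  have linG: "linear (\<lambda>v. metric_rep A a g (\<phi> y) v w)" "linear (\<lambda>w. metric_rep A a g (\<phi> y) v w)"
    if "y \<in> S" for y v w
    using linear_compose[OF linc[OF inv_a[OF that]]] bil unfolding bilinear_def metric_rep_def o_def by blast+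
  have G: "((\<lambda>y. metric_rep A a g (\<phi> y) v w) has_derivative
      (\<lambda>h. g (f p) (C (f p) (tangent_map B A f p h) v) w + g (f p) v (C (f p) (tangent_map B A f p h) w)))
      (at x)" for v w
  proof -
    have "((\<lambda>y. metric_rep A a g y v w) has_derivative
        (\<lambda>h. g (f p) (C (f p) h v) w + g (f p) v (C (f p) h w))) (at (\<phi> x))"
      unfolding \<phi>x a_def by (rule metric_rep_has_derivative[OF A g lc])
    from has_derivative_compose[OF d\<phi> this] show ?thesis .
  qed
  note lins = bilinear_ladd[OF bil] bilinear_radd[OF bil] bilinear_lmul[OF bil] bilinear_rmul[OF bil]
    bilinear_radd[OF bilC] bilinear_rmul[OF bilC]
  have Gx: "metric_rep A a g (\<phi> x) v w = g (f p) v w" for v w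
    unfolding \<phi>x metric_rep_def using A a coord_field_chart_at[OF A, of "f p"] by (simp add: a_def)
  have GZ: "((\<lambda>y. metric_rep A a g (\<phi> y) v (ZZ y)) has_derivative
      (\<lambda>h. (g (f p) (C (f p) (tangent_map B A f p h) v) (ZZ x) + g (f p) v (C (f p) (tangent_map B A f p h) (ZZ x)))
        + metric_rep A a g (\<phi> x) v (Z' h))) (at x)" for v
    by (rule has_derivative_linear_family[OF S(1,2) linG(2) G _ Z'])
      (auto intro!: linearI simp: lins algebra_simps)
  have "((\<lambda>y. metric_rep A a g (\<phi> y) (YY y) (ZZ y)) has_derivative
      (\<lambda>h. ((g (f p) (C (f p) (tangent_map B A f p h) (YY x)) (ZZ x) +
           g (f p) (YY x) (C (f p) (tangent_map B A f p h) (ZZ x)))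
        + metric_rep A a g (\<phi> x) (YY x) (Z' h)) + metric_rep A a g (\<phi> x) (Y' h) (ZZ x))) (at x)"
    by (rule has_derivative_linear_family[where L = "\<lambda>y v. metric_rep A a g (\<phi> y) v (ZZ y)",
          OF S(1,2) linG(1) GZ _ Y'])
      (auto intro!: linearI simp: Gx lins algebra_simps)
  then have "(((\<lambda>q. induced_metric B A g f q (Y q) (Z q)) \<circ> chart_inv b) has_derivative
      (\<lambda>h. ((g (f p) (C (f p) (tangent_map B A f p h) (YY x)) (ZZ x) +
           g (f p) (YY x) (C (f p) (tangent_map B A f p h) (ZZ x)))
        + metric_rep A a g (\<phi> x) (YY x) (Z' h)) + metric_rep A a g (\<phi> x) (Y' h) (ZZ x))) (at x)"
    using S(1,2)
  proof (rule has_derivative_transform_within_open)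
    fix y assume y: "y \<in> S"
    define q where "q = chart_inv b y"
    have q: "q \<in> fst b" "f q \<in> fst a" "snd b q = y" using S(5)[OF y] by (auto simp: q_def)
    have "chart_inv a (\<phi> y) = f q"
      using q A a by (simp add: \<phi>_def flip: q_def)
    then show "metric_rep A a g (\<phi> y) (YY y) (ZZ y) = ((\<lambda>q. induced_metric B A g f q (Y q) (Z q)) \<circ> chart_inv b) y"
      using coord_field_field_rep[where f = f, OF B A b(1) a(1) q(1,2)] q(3)
      by (simp add: metric_rep_def YY_def ZZ_def induced_metric_def push_def flip: q_def)
  qed
  then have "dir_deriv B (\<lambda>q. induced_metric B A g f q (Y q) (Z q)) p v =
     ((g (f p) (C (f p) (tangent_map B A f p v) (YY x)) (ZZ x) +
           g (f p) (YY x) (C (f p) (tangent_map B A f p v) (ZZ x)))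
        + metric_rep A a g (\<phi> x) (YY x) (Z' v)) + metric_rep A a g (\<phi> x) (Y' v) (ZZ x)"
    unfolding dir_deriv_def x_def b_def by (simp add: frechet_derivative_eqI)
  moreover have "cov_deriv A C B f (push B A f Y) p v = Y' v + C (f p) (tangent_map B A f p v) (push B A f Y p)"
    "cov_deriv A C B f (push B A f Z) p v = Z' v + C (f p) (tangent_map B A f p v) (push B A f Z p)"
    using frechet_derivative_eqI[OF Y'] frechet_derivative_eqI[OF Z']
    unfolding cov_deriv_def YY_def ZZ_def a_def b_def x_def by auto
  ultimately show ?thesis
    by (simp add: Gx lins Yx Zx)
qed

subsection \<open>Derivatives of tangent vectors\<close>

text \<open>An injective linear limit map is bounded below, so near the limit the preimages of
  \<open>y t\<close> are bounded by a multiple of \<open>norm (y t)\<close>. On bounded vectors the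
  maps converge uniformly; hence \<open>y0\<close> is a limit of values of the limit map, whose
  range is closed.\<close>

lemma limit_in_range:
  fixes \<Phi> :: "'x \<Rightarrow> 'f::euclidean_space \<Rightarrow> 'e::euclidean_space"
  assumes F: "F \<noteq> bot" and lin: "\<forall>\<^sub>F t in F. linear (\<Phi> t)"
    and lim: "\<And>z. ((\<lambda>t. \<Phi> t z) \<longlongrightarrow> \<Phi>0 z) F" and lin0: "linear \<Phi>0" and inj: "inj \<Phi>0"
    and y: "(y \<longlongrightarrow> y0) F" and mem: "\<forall>\<^sub>F t in F. y t \<in> range (\<Phi> t)"
  shows "y0 \<in> range \<Phi>0"
proof -
  obtain c where c: "c > 0" "\<And>z. c * norm z \<le> norm (\<Phi>0 z)"
    using linear_inj_bounded_below_pos[OF lin0 inj] by (metis mult.commute)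
  define \<eta> where "\<eta> t = (\<Sum>i\<in>Basis. norm (\<Phi> t i - \<Phi>0 i))" for t
  have \<eta>: "(\<eta> \<longlongrightarrow> 0) F"
    unfolding \<eta>_def by (intro tendsto_null_sum tendsto_norm_zero Lim_null[THEN iffD1] lim)
  have bound: "norm (\<Phi> t z - \<Phi>0 z) \<le> norm z * \<eta> t" if "linear (\<Phi> t)" for t z
  proof -
    have "\<Phi> t z - \<Phi>0 z = (\<Sum>i\<in>Basis. (z \<bullet> i) *\<^sub>R (\<Phi> t i - \<Phi>0 i))"
      using linear_euclidean_expand[OF that, of z] linear_euclidean_expand[OF lin0, of z]
      by (simp add: sum_subtractf scaleR_diff_right)
    also have "norm \<dots> \<le> (\<Sum>i\<in>Basis. norm z * norm (\<Phi> t i - \<Phi>0 i))"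
      by (rule sum_norm_le) (simp add: Basis_le_norm mult_right_mono)
    finally show ?thesis
      by (simp add: \<eta>_def sum_distrib_left)
  qed
  define z where "z t = (SOME z. y t = \<Phi> t z)" for t
  have z: "\<forall>\<^sub>F t in F. y t = \<Phi> t (z t)"
    using mem by eventually_elim (auto simp: z_def intro: someI)
  have "\<forall>\<^sub>F t in F. \<eta> t < c / 2"
    by (rule order_tendstoD(2)[OF \<eta>]) (use c in simp)
  with z lin have close: "\<forall>\<^sub>F t in F. norm (\<Phi>0 (z t) - y t) \<le> 2 / c * norm (y t) * \<eta> t"
  proof eventually_elim
    case (elim t)
    have \<eta>0: "\<eta> t \<ge> 0" by (simp add: \<eta>_def sum_nonneg)
    have le: "norm (\<Phi>0 (z t) - y t) \<le> norm (z t) * \<eta> t"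
      using bound[OF elim(2), of "z t"] elim(1) by (simp add: norm_minus_commute)
    \<comment> \<open>Since \<open>\<eta> t\<close> is below \<open>c / 2\<close>, half of the
      left-hand side absorbs the error term, which leaves a bound on
      \<open>norm (z t)\<close>.\<close>
    have "c * norm (z t) \<le> norm (y t) + norm (\<Phi>0 (z t) - y t)"
      using c(2)[of "z t"] norm_triangle_ineq[of "y t" "\<Phi>0 (z t) - y t"] by simp
    also have "\<dots> \<le> norm (y t) + norm (z t) * (c / 2)"
      using le mult_left_mono[of "\<eta> t" "c/2" "norm (z t)"] elim(3) by simp
    finally have "norm (z t) \<le> 2 / c * norm (y t)"
      using c(1) by (simp add: field_simps)
    then show ?case
      using le mult_right_mono[of "norm (z t)" "2 / c * norm (y t)" "\<eta> t"] \<eta>0 by linarith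
  qed
  have "((\<lambda>t. 2 / c * norm (y t) * \<eta> t) \<longlongrightarrow> 2 / c * norm y0 * 0) F"
    by (intro tendsto_mult tendsto_const tendsto_norm y \<eta>)
  then have "((\<lambda>t. \<Phi>0 (z t) - y t) \<longlongrightarrow> 0) F"
    by (intro Lim_null_comparison[OF close]) simp
  from tendsto_add[OF this y] have "((\<lambda>t. \<Phi>0 (z t)) \<longlongrightarrow> y0) F" by simp
  moreover have "closed (range \<Phi>0)"
    by (intro closed_subspace linear_subspace_image[OF lin0] subspace_UNIV)
  ultimately show ?thesis
    using F by (intro Lim_in_closed_set[of "range \<Phi>0"]) auto
qed

text \<open>The difference quotients of \<open>W t - \<Phi> t z0\<close> lie in the range of \<open>\<Phi> t\<close>; so no differentiable
  choice of preimages of \<open>W t\<close> is needed.\<close>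

lemma derivative_in_range:
  fixes \<Phi> :: "real \<Rightarrow> 'f::euclidean_space \<Rightarrow> 'e::euclidean_space"
  assumes lin: "\<forall>\<^sub>F t in at 0. linear (\<Phi> t)" and lin0: "linear (\<Phi> 0)" and inj: "inj (\<Phi> 0)"
    and \<Phi>: "\<And>z. ((\<lambda>t. \<Phi> t z) has_vector_derivative \<Phi>' z) (at 0)"
    and W: "(W has_vector_derivative W') (at 0)"
    and mem: "\<forall>\<^sub>F t in at 0. W t \<in> range (\<Phi> t)" and W0: "W 0 = \<Phi> 0 z0"
  shows "W' - \<Phi>' z0 \<in> range (\<Phi> 0)"
proof (rule limit_in_range[OF _ lin _ lin0 inj])
  show "(at 0 :: real filter) \<noteq> bot" by simp
  show "((\<lambda>t. \<Phi> t z) \<longlongrightarrow> \<Phi> 0 z) (at 0)" for z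
    using has_vector_derivative_continuous[OF \<Phi>[of z]] by (simp add: isCont_def)
  have "((\<lambda>t. W t - \<Phi> t z0) has_vector_derivative W' - \<Phi>' z0) (at 0)"
    by (rule has_vector_derivative_diff[OF W \<Phi>])
  then have "((\<lambda>t. norm (W t - \<Phi> t z0 - t *\<^sub>R (W' - \<Phi>' z0)) / norm t) \<longlongrightarrow> 0) (at 0)"
    by (simp add: has_vector_derivative_def has_derivative_at W0)
  moreover have "norm (W t - \<Phi> t z0 - t *\<^sub>R (W' - \<Phi>' z0)) / norm t =
      norm ((1 / t) *\<^sub>R (W t - \<Phi> t z0) - (W' - \<Phi>' z0))" if "t \<noteq> 0" for t
  proof -
    have "(1 / t) *\<^sub>R (W t - \<Phi> t z0) - (W' - \<Phi>' z0) =
        (1 / t) *\<^sub>R (W t - \<Phi> t z0 - t *\<^sub>R (W' - \<Phi>' z0))"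
      using that by (simp add: scaleR_diff_right)
    then show ?thesis by simp
  qed
  then have "\<forall>\<^sub>F t in at 0. norm (W t - \<Phi> t z0 - t *\<^sub>R (W' - \<Phi>' z0)) / norm t =
      norm ((1 / t) *\<^sub>R (W t - \<Phi> t z0) - (W' - \<Phi>' z0))"
    by (simp add: eventually_at_filter)
  ultimately have "((\<lambda>t. norm ((1 / t) *\<^sub>R (W t - \<Phi> t z0) - (W' - \<Phi>' z0))) \<longlongrightarrow> 0) (at 0)"
    by (rule Lim_transform_eventually)
  then show "((\<lambda>t. (1 / t) *\<^sub>R (W t - \<Phi> t z0)) \<longlongrightarrow> W' - \<Phi>' z0) (at 0)"
    by (rule LIM_zero_cancel[OF tendsto_norm_zero_cancel])
  show "\<forall>\<^sub>F t in at 0. (1 / t) *\<^sub>R (W t - \<Phi> t z0) \<in> range (\<Phi> t)"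
    using lin mem
  proof eventually_elim
    case (elim t)
    then obtain z where "W t = \<Phi> t z" by auto
    then have "(1 / t) *\<^sub>R (W t - \<Phi> t z0) = \<Phi> t ((1 / t) *\<^sub>R (z - z0))"
      using elim(1) by (simp add: linear_scale linear_diff)
    then show ?case by blast
  qed
qed

lemma has_derivative_along_ray:
  assumes "(G has_derivative G') (at 0)"
  shows "((\<lambda>t::real. G (t *\<^sub>R w)) has_vector_derivative G' w) (at 0)"
proof -
  have "((\<lambda>t::real. t *\<^sub>R w) has_derivative (\<lambda>h. h *\<^sub>R w)) (at 0)"
    by (auto intro!: derivative_eq_intros)
  moreover have "(G has_derivative G') (at ((0::real) *\<^sub>R w))"
    using assms by simp
  ultimately have "((\<lambda>t::real. G (t *\<^sub>R w)) has_derivative (\<lambda>h. G' (h *\<^sub>R w))) (at 0)"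
    by (rule has_derivative_compose)
  then show ?thesis
    unfolding has_vector_derivative_def
    by (simp add: linear_scale[OF has_derivative_linear[OF assms]])
qed

subsection \<open>The Gauss formula\<close>

text \<open>The components of \<open>Y\<close> are constant near \<open>p\<close> and contribute no
  derivative of their own; what remains is the second derivative of the coordinate expression of
  \<open>f\<close> and the Christoffel term.\<close>

lemma cov_deriv_push_coord_field:
  fixes A :: "('a::t2_space, 'e::euclidean_space) chart set"
    and B :: "('b::t2_space, 'f::euclidean_space) chart set" and p :: 'b
  assumes B: "smooth_atlas B" and A: "smooth_atlas A" and f: "smooth_map B A f"
  defines "b \<equiv> chart_at B p" and "a \<equiv> chart_at A (f p)"
  assumes Y: "smooth_field B Y" and U: "open U" "p \<in> U"
    and YU: "\<And>q. q \<in> U \<Longrightarrow> Y q = coord_field B b w q"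
  shows "cov_deriv A C B f (push B A f Y) p v =
    frechet_derivative (\<lambda>x. frechet_derivative (snd a \<circ> f \<circ> chart_inv b) (at x) w) (at (snd b p)) v +
    C (f p) (tangent_map B A f p v) (tangent_map B A f p w)"
proof -
  have b: "b \<in> B" "p \<in> fst b" and a: "a \<in> A" "f p \<in> fst a"
    using chart_at_in[OF B] in_chart_at[OF B] chart_at_in[OF A] in_chart_at[OF A]
    by (auto simp: a_def b_def)
  have D0: "frechet_derivative (field_rep B (\<lambda>q. q) b b Y) (at (snd b p)) h = 0" for h
    unfolding b_def by (rule frechet_derivative_coord_field[OF B U]) (simp add: YU b_def)
  have Yp: "Y p = w"
    using YU[OF U(2)] coord_field_chart_at[OF B, of p w] by (simp add: b_def)
  have rep: "field_rep B (\<lambda>q. q) b b Y (snd b p) = w"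
    using chart_change_self[OF B b, of w] by (simp add: field_rep_at[OF B b] Yp flip: b_def)
  have "linear (local_deriv b a f p)"
    by (rule linear_local_deriv[OF f b(1) a(1) b(2) a(2)])
  then have "frechet_derivative (field_rep A f b a (push B A f Y)) (at (snd b p)) v =
      frechet_derivative (\<lambda>x. frechet_derivative (snd a \<circ> f \<circ> chart_inv b) (at x) w) (at (snd b p)) v"
    using frechet_derivative_eqI[OF field_rep_push_has_derivative[OF B A f Y b(1) a(1) b(2) a(2)]]
    by (simp add: D0 rep linear_0)
  then show ?thesis
    by (simp add: cov_deriv_def push_def Yp flip: a_def b_def)
qed

text \<open>This passes from fields to vectors at \<open>p\<close>: both \<open>v\<close> and
  \<open>w\<close> are values of globally smooth fields. Working modulo \<open>range T\<close>
  absorbs the induced connection, whatever vector its description operator yields.\<close>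

lemma totally_umbilical_hessian:
  fixes A :: "('a::t2_space, 'e::euclidean_space) chart set"
    and B :: "('b::t2_space, 'f::euclidean_space) chart set" and p :: 'b
  assumes B: "smooth_atlas B" and A: "smooth_atlas A" and f: "smooth_map B A f"
  defines "b \<equiv> chart_at B p" and "a \<equiv> chart_at A (f p)" and "T \<equiv> tangent_map B A f p"
  assumes H: "\<And>X Y. smooth_field B X \<Longrightarrow> smooth_field B Y \<Longrightarrow>
    second_fund_form B A C f St L X Y p = induced_metric B A g f p (X p) (Y p) *\<^sub>R h"
  shows "frechet_derivative (\<lambda>x. frechet_derivative (snd a \<circ> f \<circ> chart_inv b) (at x) w) (at (snd b p)) v +
    C (f p) (T v) (T w) - g (f p) (T v) (T w) *\<^sub>R h \<in> range T"
proof -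
  obtain X where X: "smooth_field B X" "X p = v"
    using coord_field_extension_at[OF B, of p v] by blast
  obtain Y U where Y: "smooth_field B Y" "open U" "p \<in> U" "U \<subseteq> fst b"
    "\<And>q. q \<in> U \<Longrightarrow> Y q = coord_field B b w q" "Y p = w"
    using coord_field_extension_at[OF B, of p w, folded b_def] by blast
  have "cov_deriv A C B f (push B A f Y) p v - g (f p) (T v) (T w) *\<^sub>R h =
      T (induced_connection B A C f St L X Y p)"
    using H[OF X(1) Y(1)] X(2) Y(6)
    by (simp add: second_fund_form_def induced_metric_def T_def algebra_simps)
  then have "cov_deriv A C B f (push B A f Y) p v - g (f p) (T v) (T w) *\<^sub>R h \<in> range T"
    by (simp only: rangeI)
  moreover have "cov_deriv A C B f (push B A f Y) p v =
    frechet_derivative (\<lambda>x. frechet_derivative (snd a \<circ> f \<circ> chart_inv b) (at x) w) (at (snd b p)) v +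
    C (f p) (T v) (T w)"
    unfolding a_def b_def T_def
    by (rule cov_deriv_push_coord_field[OF B A f Y(1-3)]) (simp add: Y(5) b_def[symmetric])
  ultimately show ?thesis by (simp only:)
qed

subsection \<open>Integral manifolds of a complex distribution\<close>

lemma euclidean_chart:
  fixes b0 :: "('f::euclidean_space, 'f) chart"
  defines "b0 \<equiv> (UNIV, \<lambda>x. x)"
  shows "smooth_atlas {b0}" "chart_at {b0} x = b0" "chart_inv b0 = (\<lambda>x. x)"
proof -
  show inv: "chart_inv b0 = (\<lambda>x. x)"
    by (auto simp: chart_inv_def b0_def inv_into_def)
  show "chart_at {b0} x = b0"
    unfolding chart_at_def b0_def by (rule some_equality) auto
  show "smooth_atlas {b0}"
    using smooth_on_ident[OF open_UNIV]
    by (simp add: smooth_atlas_def inv homeomorphism_def o_def) (simp add: b0_def)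
qed

lemma structure_rep_at:
  assumes "smooth_atlas A" "c \<in> A" "p \<in> fst c"
  shows "structure_rep A c J (snd c p) v =
    chart_change (chart_at A p) c p (J p (chart_change c (chart_at A p) p v))"
  using assms by (simp add: structure_rep_def field_rep_at[OF assms] coord_field_def)

text \<open>\<open>J\<close> of the coordinate field in direction \<open>v\<close> stays tangent to
  the submanifold along the integral manifold. Its ambient derivative in direction \<open>w\<close>
  is, by parallelism, \<open>J\<close> of the ambient derivative of the coordinate field; by
  umbilicity it is, modulo tangent vectors, a metric coefficient times \<open>h\<close>. The claim
  compares the two values.\<close>

lemma integral_manifold_hessian:
  fixes A :: "('a::t2_space, 'e::euclidean_space) chart set"
    and B :: "('b::t2_space, 'f::euclidean_space) chart set" and p :: 'b
    and u :: "'f \<Rightarrow> 'b"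
  assumes K: "indefinite_kaehler A J g C" and f: "immersed_submanifold B A f"
    and E: "\<And>q. E q \<subseteq> tangent_space B A f q" "\<And>q. J (f q) ` E q \<subseteq> E q"
    and KK: "subspace KK" and u: "smooth_map {(UNIV, \<lambda>x. x)} B u" and u0: "u 0 = p"
    and uE: "\<And>x. x \<in> KK \<Longrightarrow> tangent_map {(UNIV, \<lambda>x. x)} B u x ` KK \<subseteq> tangent_map B A f (u x) -` E (u x)"
    and v: "v \<in> KK" and w: "w \<in> KK"
  defines "a \<equiv> chart_at A (f p)" and "b \<equiv> chart_at B p" and "T \<equiv> tangent_map B A f p"
  defines "\<psi> \<equiv> (\<lambda>x. snd a (f (u x)))" and "D \<equiv> (\<lambda>x. T (tangent_map {(UNIV, \<lambda>x. x)} B u 0 x))"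
  assumes umb: "\<And>v w. frechet_derivative (\<lambda>x. frechet_derivative (snd a \<circ> f \<circ> chart_inv b) (at x) w) (at (snd b p)) v +
    C (f p) (T v) (T w) - g (f p) (T v) (T w) *\<^sub>R h \<in> range T"
  shows "J (f p) (frechet_derivative (\<lambda>x. frechet_derivative \<psi> (at x) v) (at 0) w + C (f p) (D w) (D v))
    - g (f p) (D w) (J (f p) (D v)) *\<^sub>R h \<in> range T"
proof -
  define b0 :: "('f, 'f) chart" where "b0 = (UNIV, \<lambda>x. x)"
  note eucl = euclidean_chart[where 'f = 'f, folded b0_def]
  have b0_simps [simp]: "fst b0 = UNIV" "snd b0 = (\<lambda>x. x)" by (auto simp: b0_def)
  have B: "smooth_atlas B" and sf: "smooth_map B A f" and injT: "\<And>q. inj (tangent_map B A f q)"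
    using f by (auto simp: immersed_submanifold_def)
  have A: "smooth_atlas A" and acs: "almost_complex_structure A J" and lc: "levi_civita A g C"
    using K by (auto simp: indefinite_kaehler_def)
  have linJ: "linear (J q)" for q
    using acs by (simp add: almost_complex_structure_def)
  have linC: "linear (C q z)" "linear (\<lambda>y. C q y z)" for q z
    using lc by (simp_all add: levi_civita_def affine_connection_def bilinear_def)
  note su = u[folded b0_def]
  have b: "b \<in> B" "p \<in> fst b" and a: "a \<in> A" "f p \<in> fst a"
    using chart_at_in[OF B] in_chart_at[OF B] chart_at_in[OF A] in_chart_at[OF A]
    by (auto simp: a_def b_def)
  define N where "N = u -` (fst b \<inter> f -` fst a)"
  have cont_u: "continuous_on UNIV u" using su by (simp add: smooth_map_def)
  have N: "open N" "0 \<in> N"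
    unfolding N_def
    using continuous_open_preimage[OF cont_u open_UNIV open_smooth_map_dom(1)[OF B A sf b(1) a(1)]] a b u0
    by auto
  have sF: "smooth_map {b0} A (\<lambda>x. f (u x))"
    by (rule smooth_map_compose[OF eucl(1) B A su sf])
  have \<psi>_eq: "snd a \<circ> (\<lambda>x. f (u x)) \<circ> chart_inv b0 = \<psi>"
    by (auto simp: \<psi>_def eucl(3))
  have s\<psi>: "smooth_on N \<psi>"
    by (rule smooth_on_subset[OF smooth_map_smooth_on[OF sF _ a(1), of b0, unfolded \<psi>_eq]
          open_smooth_map_dom(2)[OF eucl(1) A sF _ a(1), of b0]])
      (auto simp: N_def)
  have D\<psi>_eq: "frechet_derivative \<psi> (at x) = local_deriv b0 a (\<lambda>x. f (u x)) x" for x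
    by (simp add: local_deriv_def \<psi>_eq)
  have D\<psi>: "frechet_derivative \<psi> (at x) z = local_deriv b a f (u x) (local_deriv b0 b u x z)"
    if "x \<in> N" for x z
    unfolding D\<psi>_eq by (rule local_deriv_compose[OF eucl(1) B su sf _ b(1) a(1)]) (use that in \<open>auto simp: N_def\<close>)
  have tu: "tangent_map {b0} B u x = local_deriv b0 (chart_at B (u x)) u x" for x
    by (simp add: tangent_map_eq_local_deriv eucl(2))
  have tu0: "tangent_map {b0} B u 0 = local_deriv b0 b u 0"
    by (simp add: tu u0 b_def)
  have T_eq: "T = local_deriv b a f p"
    by (simp add: T_def tangent_map_eq_local_deriv a_def b_def)
  have D_eq: "D z = frechet_derivative \<psi> (at 0) z" for z
    using D\<psi>[OF N(2)] tu0 by (simp add: D_def T_eq u0 b0_def)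
  have \<psi>0: "\<psi> 0 = snd a (f p)" by (simp add: \<psi>_def u0)
  define R where "R x = structure_rep A a J (\<psi> x) (frechet_derivative \<psi> (at x) v)" for x
  have Rmem: "R x \<in> range (local_deriv b a f (u x))" if x: "x \<in> N" "x \<in> KK" for x
  proof -
    \<comment> \<open>\<open>E\<close>, \<open>J\<close> and the tangent maps are tied to the charts
      selected at the moving points, hence the detour through \<open>c\<close> and \<open>d\<close>
      and back to the fixed charts \<open>a\<close> and \<open>b\<close>.\<close>
    define q where "q = f (u x)"
    define c where "c = chart_at A q"
    define d where "d = chart_at B (u x)"
    have c: "c \<in> A" "q \<in> fst c" and d: "d \<in> B" "u x \<in> fst d" and q: "q \<in> fst a" "u x \<in> fst b"
      using chart_at_in[OF B] in_chart_at[OF B] chart_at_in[OF A] in_chart_at[OF A] x(1)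
      by (auto simp: c_def d_def N_def q_def)
    have "chart_change a c q (frechet_derivative \<psi> (at x) v) = local_deriv b0 c (\<lambda>x. f (u x)) x v"
      unfolding D\<psi>_eq q_def
      by (rule chart_change_local_deriv[OF eucl(1) A sF _ a(1) c(1)]) (use c q in \<open>auto simp: q_def\<close>)
    also have "\<dots> = local_deriv d c f (u x) (local_deriv b0 d u x v)"
      by (rule local_deriv_compose[OF eucl(1) B su sf _ d(1) c(1)]) (use c d in \<open>auto simp: q_def\<close>)
    also have "\<dots> = tangent_map B A f (u x) (tangent_map {b0} B u x v)"
      by (simp add: tu tangent_map_eq_local_deriv[of B A] c_def d_def q_def)
    also have "\<dots> \<in> E (u x)"
      using uE[OF x(2)] v by (auto simp: b0_def)
    finally have "J q (chart_change a c q (frechet_derivative \<psi> (at x) v)) \<in> range (tangent_map B A f (u x))"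
      using E by (fastforce simp: tangent_space_def q_def)
    then obtain z where z: "J q (chart_change a c q (frechet_derivative \<psi> (at x) v)) = local_deriv d c f (u x) z"
      by (auto simp: tangent_map_eq_local_deriv[of B A] c_def d_def q_def)
    have "R x = chart_change c a q (local_deriv d c f (u x) z)"
      using structure_rep_at[OF A a(1) q(1), of J] z by (simp add: R_def \<psi>_def c_def flip: q_def)
    also have "\<dots> = local_deriv d a f (u x) z"
      unfolding q_def
      by (rule chart_change_local_deriv[OF B A sf d(1) c(1) a(1) d(2)]) (use c q in \<open>auto simp: q_def\<close>)
    also have "\<dots> = local_deriv b a f (u x) (chart_change d b (u x) z)"
      by (rule local_deriv_chart_change[OF B A sf d(1) b(1) a(1) d(2) q(2), symmetric]) (use q in \<open>auto simp: q_def\<close>)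
    finally show ?thesis by blast
  qed
  have str0: "structure_rep A a J (\<psi> 0) e = J (f p) e" for e
    unfolding \<psi>0 structure_rep_at[OF A a] using chart_change_self[OF A a] by (simp flip: a_def)
  have R0: "R 0 = J (f p) (D v)"
    by (simp add: R_def str0 D_eq)
  have "tangent_map {b0} B u 0 v \<in> T -` E p"
    using uE[of 0] subspace_0[OF KK] v by (auto simp: T_def u0 b0_def)
  then have "J (f p) (D v) \<in> E p"
    using E(2)[of p] by (auto simp: D_def b0_def)
  \<comment> \<open>A preimage is fixed at the base point only; along the ray in direction
    \<open>w\<close>, membership in the moving ranges takes the place of a varying preimage.\<close>
  then obtain z0 where z0: "J (f p) (D v) = T z0"
    using E(1)[of p] by (auto simp: tangent_space_def T_def)
  have R': "(R has_derivative (\<lambda>k. (J (f p) (C (f p) (D k) (D v)) - C (f p) (D k) (J (f p) (D v))) +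
      J (f p) (frechet_derivative (\<lambda>x. frechet_derivative \<psi> (at x) v) (at 0) k))) (at 0)"
  proof -
    have lin: "linear (structure_rep A a J (\<psi> x))" if "x \<in> N" for x
    proof -
      have q: "f (u x) \<in> fst a" using that by (simp add: N_def)
      have "linear (\<lambda>v. chart_change (chart_at A (f (u x))) a (f (u x))
          (J (f (u x)) (chart_change a (chart_at A (f (u x))) (f (u x)) v)))"
        using linear_compose[OF linear_compose[OF
              linear_chart_change[OF A a(1) chart_at_in[OF A] q in_chart_at[OF A]] linJ]
            linear_chart_change[OF A chart_at_in[OF A] a(1) in_chart_at[OF A] q]]
        by (simp add: o_def)
      then show ?thesis
        unfolding \<psi>_def structure_rep_at[OF A a(1) q, abs_def] .
    qed
    have L: "((\<lambda>x. structure_rep A a J (\<psi> x) e) has_derivative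
        (\<lambda>k. J (f p) (C (f p) (D k) e) - C (f p) (D k) (J (f p) e))) (at 0)" for e
    proof -
      have "((\<lambda>y. structure_rep A a J y e) has_derivative
          (\<lambda>k. J (f p) (C (f p) k e) - C (f p) k (J (f p) e))) (at (\<psi> 0))"
        unfolding \<psi>0 a_def by (rule structure_rep_has_derivative[OF K])
      from has_derivative_compose[OF smooth_on_has_derivative[OF s\<psi> N(2)] this]
      show ?thesis by (simp add: D_eq)
    qed
    have lin': "linear (\<lambda>e. J (f p) (C (f p) (D k) e) - C (f p) (D k) (J (f p) e))" for k
      by (rule linear_compose_sub[OF linear_compose[OF linC(1) linJ, unfolded o_def]
            linear_compose[OF linJ linC(1), unfolded o_def]])
    show ?thesis
      using has_derivative_linear_family[OF N lin L lin'
          smooth_on_has_derivative[OF smooth_on_frechet_derivative[OF s\<psi>] N(2)], of v]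
      by (simp add: R_def[abs_def] str0 flip: D_eq)
  qed
  define \<phi> where "\<phi> = snd a \<circ> f \<circ> chart_inv b"
  define \<omega> where "\<omega> = tangent_map {b0} B u 0 w"
  have T\<omega>: "T \<omega> = D w" by (simp add: \<omega>_def D_def b0_def)
  have s\<phi>: "smooth_on (snd b ` (fst b \<inter> f -` fst a)) \<phi>"
    unfolding \<phi>_def by (rule smooth_map_smooth_on[OF sf b(1) a(1)])
  \<comment> \<open>Along the ray, and in the fixed charts, the tangent spaces of the submanifold
    are the ranges of this family. Its derivative is the second derivative of \<open>\<phi>\<close>
    with outer direction \<open>\<omega>\<close>, the velocity of the ray in the
    submanifold.\<close>
  have \<Phi>: "((\<lambda>t. local_deriv b a f (u (t *\<^sub>R w)) z) has_vector_derivative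
      frechet_derivative (\<lambda>x. frechet_derivative \<phi> (at x) z) (at (snd b p)) \<omega>) (at 0)" for z
  proof -
    have "(snd b \<circ> u \<circ> chart_inv b0 has_derivative local_deriv b0 b u 0) (at (snd b0 0))"
      by (rule local_deriv_has_derivative[OF su _ b(1)]) (use b u0 in auto)
    then have 1: "((\<lambda>x. snd b (u x)) has_derivative local_deriv b0 b u 0) (at 0)"
      by (simp add: eucl(3) o_def)
    have 2: "((\<lambda>x. frechet_derivative \<phi> (at x) z) has_derivative
        frechet_derivative (\<lambda>x. frechet_derivative \<phi> (at x) z) (at (snd b p))) (at (snd b (u 0)))"
      unfolding u0 by (rule smooth_on_has_derivative[OF smooth_on_frechet_derivative[OF s\<phi>]])
        (use a b in auto)
    show ?thesis
      using has_derivative_along_ray[OF has_derivative_compose[OF 1 2], of w]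
      by (simp add: local_deriv_def \<phi>_def \<omega>_def tu0)
  qed
  have ev: "\<forall>\<^sub>F t in at (0::real). t *\<^sub>R w \<in> N"
  proof -
    have "((\<lambda>t::real. t *\<^sub>R w) \<longlongrightarrow> 0 *\<^sub>R w) (at 0)"
      by (intro tendsto_intros)
    then show ?thesis using topological_tendstoD N by fastforce
  qed
  have "((J (f p) (C (f p) (D w) (D v)) - C (f p) (D w) (J (f p) (D v))) +
      J (f p) (frechet_derivative (\<lambda>x. frechet_derivative \<psi> (at x) v) (at 0) w)) -
      frechet_derivative (\<lambda>x. frechet_derivative \<phi> (at x) z0) (at (snd b p)) \<omega>
      \<in> range (local_deriv b a f (u (0 *\<^sub>R w)))"
  proof (rule derivative_in_range[OF _ _ _ \<Phi> has_derivative_along_ray[OF R', of w]])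
    show "\<forall>\<^sub>F t in at 0. linear (local_deriv b a f (u (t *\<^sub>R w)))"
      using ev by eventually_elim (auto simp: N_def intro: linear_local_deriv[OF sf b(1) a(1)])
    show "linear (local_deriv b a f (u (0 *\<^sub>R w)))"
      using a b by (auto simp: u0 intro: linear_local_deriv[OF sf b(1) a(1)])
    show "inj (local_deriv b a f (u (0 *\<^sub>R w)))"
      using injT[of p] by (simp add: u0 flip: T_eq T_def)
    show "\<forall>\<^sub>F t in at 0. R (t *\<^sub>R w) \<in> range (local_deriv b a f (u (t *\<^sub>R w)))"
      using ev by eventually_elim (rule Rmem, auto intro: subspace_scale[OF KK w])
    show "R (0 *\<^sub>R w) = local_deriv b a f (u (0 *\<^sub>R w)) z0"
      by (simp add: R0 z0 u0 T_eq)
  qed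
  then have mem1: "((J (f p) (C (f p) (D w) (D v)) - C (f p) (D w) (J (f p) (D v))) +
      J (f p) (frechet_derivative (\<lambda>x. frechet_derivative \<psi> (at x) v) (at 0) w)) -
      frechet_derivative (\<lambda>x. frechet_derivative \<phi> (at x) z0) (at (snd b p)) \<omega> \<in> range T"
    by (simp add: u0 T_eq)
  \<comment> \<open>Umbilicity for the vectors \<open>\<omega>\<close> and \<open>z0\<close>, whose
    images are \<open>D w\<close> and \<open>J (f p) (D v)\<close>. In the sum with
    \<open>mem1\<close> the second derivative of \<open>\<phi>\<close> and the term
    \<open>C (f p) (D w) (J (f p) (D v))\<close> cancel.\<close>
  have mem2: "frechet_derivative (\<lambda>x. frechet_derivative \<phi> (at x) z0) (at (snd b p)) \<omega> +
    C (f p) (D w) (J (f p) (D v)) - g (f p) (D w) (J (f p) (D v)) *\<^sub>R h \<in> range T"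
    using umb[of z0 \<omega>] by (simp add: T\<omega> z0 \<phi>_def)
  have "subspace (range T)"
    unfolding T_eq using a b
    by (intro linear_subspace_image[OF linear_local_deriv[OF sf b(1) a(1)]] subspace_UNIV) auto
  from subspace_add[OF this mem1 mem2] show ?thesis
    by (simp add: linear_add[OF linJ] algebra_simps)
qed


section \<open>Linear algebra of the transversal bundle and of \<open>D0\<close>\<close>

text \<open>Pairing with the radical annihilates tangent vectors and the screen transversal part,
  hence also the lightlike part; as the radical and \<open>L p\<close> are dual to each other, the
  lightlike part is zero. What is left is tangent and in \<open>St p\<close>, so it lies in the
  radical, which meets \<open>St p\<close> trivially.\<close>

lemma transversal_inter_tangent:
  assumes M: "lightlike_submanifold B A g f S St L"
    and bil: "bilinear (g (f p))" and sym: "\<And>v w. g (f p) v w = g (f p) w v"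
    and tr: "h \<in> transversal_space St L p" and tan: "h \<in> tangent_space B A f p"
  shows "h = 0"
proof -
  let ?g = "g (f p)" and ?T = "tangent_space B A f p" and ?Rad = "radical B A g f p"
  obtain r where St: "screen_transversal_bundle B A g f St"
    and L: "lightlike_transversal_bundle B A g f r S St L"
    using M unfolding lightlike_submanifold_def by blast
  have St_sum: "is_direct_sum (normal_space B A g f p) (St p) ?Rad"
    using St by (simp add: screen_transversal_bundle_def is_orthogonal_sum_def)
  have normal: "?g v t = 0" if "v \<in> normal_space B A g f p" "t \<in> ?T" for v t
    using that by (simp add: normal_space_def orth_space_def)
  obtain l s where h: "h = l + s" "l \<in> L p" "s \<in> St p"
    using tr by (auto simp: transversal_space_def)
  have "0 \<in> ?Rad" using St_sum by (auto simp: is_direct_sum_def)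
  then have "s + 0 \<in> normal_space B A g f p"
    using St_sum h(3) unfolding is_direct_sum_def by blast
  then have s: "s \<in> normal_space B A g f p" by simp
  have l_rad: "?g w l = 0" if w: "w \<in> ?Rad" for w
  proof -
    have w': "w \<in> ?T" "w \<in> normal_space B A g f p" using w by (auto simp: radical_def)
    have "?g w h = ?g w l + ?g w s" by (simp add: h(1) bilinear_radd[OF bil])
    then show ?thesis
      using normal[OF w'(2) tan] normal[OF s w'(1)] sym[of w s] by simp
  qed
  obtain \<xi> N where rad: "?Rad = span ((\<lambda>i. \<xi> i p) ` {..<r})" and Lp: "L p = span ((\<lambda>i. N i p) ` {..<r})"
    and dual: "\<And>i j. i < r \<Longrightarrow> j < r \<Longrightarrow> ?g (\<xi> i p) (N j p) = (if i = j then 1 else 0)"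
    using L unfolding lightlike_transversal_bundle_def by (elim conjE) metis
  \<comment> \<open>The map expands a vector in the frame \<open>N\<close> with the coefficients
    given by the dual basis of the radical. It is the identity on each frame vector, hence on their
    span \<open>L p\<close>.\<close>
  have lin: "linear (\<lambda>x. \<Sum>i<r. ?g (\<xi> i p) x *\<^sub>R N i p)"
    by (rule linearI)
      (simp_all add: bilinear_radd[OF bil] bilinear_rmul[OF bil] scaleR_add_left sum.distrib scaleR_sum_right)
  have "(\<Sum>i<r. ?g (\<xi> i p) l *\<^sub>R N i p) = l"
    using h(2) unfolding Lp
  proof (rule linear_eq_on[OF lin linear_ident])
    fix x assume "x \<in> (\<lambda>i. N i p) ` {..<r}"
    then obtain j where j: "j < r" "x = N j p" by auto
    have "(\<Sum>i<r. ?g (\<xi> i p) x *\<^sub>R N i p) = (\<Sum>i<r. if i = j then N i p else 0)"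
      using j by (intro sum.cong) (auto simp: dual)
    then show "(\<Sum>i<r. ?g (\<xi> i p) x *\<^sub>R N i p) = x"
      using j by simp
  qed
  moreover have "?g (\<xi> i p) l = 0" if "i < r" for i
    using that by (intro l_rad) (auto simp: rad intro: span_base)
  ultimately have "l = 0" by simp
  then have "h \<in> St p \<inter> ?Rad"
    using h s tan by (simp add: radical_def)
  then show ?thesis
    using St_sum by (auto simp: is_direct_sum_def)
qed

lemma subbundle_subspace:
  assumes "subbundle B A f E"
  shows "subspace (E p)"
  using assms unfolding subbundle_def subbundle_rank_def by (metis subspace_span)

lemma STCR_complex_distribution:
  assumes M: "STCR_lightlike_submanifold B A J g f S St L D0"
  shows "D0 p \<subseteq> tangent_space B A f p" "J (f p) ` D0 p = D0 p" "nondegenerate_on (g (f p)) (D0 p)"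
    "subspace (D0 p)"
proof -
  have "subbundle B A f D0"
    using M unfolding STCR_lightlike_submanifold_def by (elim conjE exE) simp
  then show "subspace (D0 p)" by (rule subbundle_subspace)
  have D0: "(\<exists>W. is_orthogonal_sum (g (f p)) (S p) W (D0 p)) \<and>
      nondegenerate_on (g (f p)) (D0 p) \<and> J (f p) ` D0 p = D0 p"
    using M unfolding STCR_lightlike_submanifold_def
    by (elim conjE exE) (drule spec[where x = p], drule spec[where x = p], blast)
  then show "nondegenerate_on (g (f p)) (D0 p)" "J (f p) ` D0 p = D0 p" by blast+
  obtain W where W: "is_orthogonal_sum (g (f p)) (S p) W (D0 p)"
    using D0 by blast
  have "D0 p \<subseteq> S p"
  proof
    fix x assume "x \<in> D0 p"
    \<comment> \<open>\<open>W\<close> is not given as a subspace; zero belongs to it because the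
      two summands of a direct sum intersect in \<open>{0}\<close>.\<close>
    have "0 \<in> W"
      using W by (auto simp: is_orthogonal_sum_def is_direct_sum_def)
    then have "0 + x \<in> S p"
      using W \<open>x \<in> D0 p\<close> unfolding is_orthogonal_sum_def is_direct_sum_def by blast
    then show "x \<in> S p" by simp
  qed
  moreover have "S p \<subseteq> tangent_space B A f p"
  proof
    fix x assume "x \<in> S p"
    have sum: "is_direct_sum (tangent_space B A f p) (S p) (radical B A g f p)"
      using M by (auto simp: STCR_lightlike_submanifold_def lightlike_submanifold_def
          screen_distribution_def is_orthogonal_sum_def)
    then have "0 \<in> radical B A g f p" by (auto simp: is_direct_sum_def)
    then have "x + 0 \<in> tangent_space B A f p"
      using sum \<open>x \<in> S p\<close> unfolding is_direct_sum_def by blast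
    then show "x \<in> tangent_space B A f p" by simp
  qed
  ultimately show "D0 p \<subseteq> tangent_space B A f p" by blast
qed

section \<open>Vanishing of the umbilicity vector at a point\<close>

lemma totally_umbilical_STCR_geodesic:
  fixes A :: "('a::t2_space, 'e::euclidean_space) chart set"
    and B :: "('b::t2_space, 'f::euclidean_space) chart set" and p :: 'b
  assumes K: "indefinite_kaehler A J g C"
    and M: "STCR_lightlike_submanifold B A J g f S St L D0"
    and D0: "D0 p \<noteq> {0}"
    and int: "integrable_distribution B (\<lambda>p. tangent_map B A f p -` D0 p)"
    and h: "h \<in> transversal_space St L p"
    and umb: "\<And>X Y. smooth_field B X \<Longrightarrow> smooth_field B Y \<Longrightarrow>
      second_fund_form B A C f St L X Y p = induced_metric B A g f p (X p) (Y p) *\<^sub>R h"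
  shows "h = 0"
proof -
  have A: "smooth_atlas A" and lc: "levi_civita A g C" and acs: "almost_complex_structure A J"
    and gJ: "\<And>p v w. g p (J p v) (J p w) = g p v w"
    using K by (auto simp: indefinite_kaehler_def)
  obtain r where g: "semi_riemannian_metric A g r"
    using K by (auto simp: indefinite_kaehler_def)
  have bil: "bilinear (g q)" and sym: "g q v w = g q w v" for q v w
    using g by (auto simp: semi_riemannian_metric_def)
  have JJ: "J q (J q v) = - v" and linJ: "linear (J q)" for q v
    using acs by (auto simp: almost_complex_structure_def)
  have LL: "lightlike_submanifold B A g f S St L"
    using M by (simp add: STCR_lightlike_submanifold_def)
  then have im: "immersed_submanifold B A f" by (simp add: lightlike_submanifold_def)
  then have B: "smooth_atlas B" and sf: "smooth_map B A f"
    by (auto simp: immersed_submanifold_def)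
  note D0f = STCR_complex_distribution[OF M]
  let ?T = "tangent_map B A f p" and ?g = "g (f p)" and ?J = "J (f p)"
  let ?b0 = "(UNIV, \<lambda>x. x) :: ('f, 'f) chart"
  obtain KK u where KK: "subspace KK" and su: "smooth_map {?b0} B u" and u0: "u 0 = p"
    and uD: "\<And>x. x \<in> KK \<Longrightarrow> tangent_map {?b0} B u x ` KK = tangent_map B A f (u x) -` D0 (u x)"
    using int unfolding integrable_distribution_def by metis
  define D where "D = (\<lambda>x. ?T (tangent_map {?b0} B u 0 x))"
  define a where "a = chart_at A (f p)"
  define \<psi> where "\<psi> = (\<lambda>x. snd a (f (u x)))"
  define Q where "Q v w = frechet_derivative (\<lambda>x. frechet_derivative \<psi> (at x) v) (at 0) w +
    C (f p) (D w) (D v)" for v w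
  have Q: "?J (Q v w) - ?g (D w) (?J (D v)) *\<^sub>R h \<in> range ?T" if "v \<in> KK" "w \<in> KK" for v w
    unfolding Q_def \<psi>_def a_def D_def
    by (rule integral_manifold_hessian[OF K im D0f(1) _ KK su u0 _ that
          totally_umbilical_hessian[OF B A sf umb]])
      (use D0f(2) uD in auto)
  \<comment> \<open>\<open>Q v w\<close> is the ambient derivative of one coordinate field of the
    integral manifold along another. Its symmetry stands for the vanishing bracket: second
    derivatives commute and the connection has no torsion.\<close>
  have Qsym: "Q v w = Q w v" for v w
  proof -
    have sF: "smooth_map {?b0} A (\<lambda>x. f (u x))"
      by (rule smooth_map_compose[OF euclidean_chart(1) B A su sf])
    obtain N where N: "open N" "snd ?b0 0 \<in> N" "smooth_on N (snd a \<circ> (\<lambda>x. f (u x)) \<circ> chart_inv ?b0)"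
      by (rule local_rep_smooth[OF euclidean_chart(1) A sF, of ?b0 a 0])
        (use u0 chart_at_in[OF A] in_chart_at[OF A] in \<open>auto simp: a_def\<close>)
    have "snd a \<circ> (\<lambda>x. f (u x)) \<circ> chart_inv ?b0 = \<psi>"
      by (auto simp: \<psi>_def euclidean_chart(3))
    then have "frechet_derivative (\<lambda>x. frechet_derivative \<psi> (at x) v) (at 0) w =
        frechet_derivative (\<lambda>x. frechet_derivative \<psi> (at x) w) (at 0) v"
      using symmetric_second_derivative[of N \<psi> 0 v w] N by simp
    then show ?thesis
      using christoffel_symmetric[OF A lc, of "f p" "D w" "D v"] by (simp add: Q_def)
  qed
  have onto: "\<exists>v\<in>KK. D v = e" if "e \<in> D0 p" for e
  proof -
    obtain x where x: "e = ?T x" using D0f(1)[of p] \<open>e \<in> D0 p\<close> by (auto simp: tangent_space_def)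
    then have "x \<in> tangent_map {?b0} B u 0 ` KK"
      using uD[OF subspace_0[OF KK]] \<open>e \<in> D0 p\<close> by (simp add: u0)
    then show ?thesis using x by (auto simp: D_def)
  qed
  obtain e where e: "e \<in> D0 p" "e \<noteq> 0"
    using D0 subspace_0[OF D0f(4), of p] by blast
  then obtain e' where e': "e' \<in> D0 p" "?g e e' \<noteq> 0"
    using D0f(3)[of p] unfolding nondegenerate_on_def by blast
  \<comment> \<open>Non-degeneracy yields a partner \<open>e'\<close> of \<open>e\<close>; as
    \<open>J\<close> maps \<open>D0 p\<close> onto itself, \<open>e'\<close> is \<open>J\<close> of
    a vector of \<open>D0 p\<close>, so the pairing has the shape of the coefficient in
    \<open>Q\<close>.\<close>
  then obtain e'' where e'': "e'' \<in> D0 p" "e' = ?J e''"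
    using D0f(2)[of p] by blast
  obtain w where w: "w \<in> KK" "D w = e" using onto[OF e(1)] by blast
  obtain v where v: "v \<in> KK" "D v = e''" using onto[OF e''(1)] by blast
  have skew: "?g e'' (?J e) = - ?g e (?J e'')"
    using gJ[of "f p" e'' "?J e"] sym[of "f p" "?J e''" e] by (simp add: JJ bilinear_rneg[OF bil])
  have "linear ?T"
    unfolding tangent_map_eq_local_deriv
    by (intro linear_local_deriv[OF sf] chart_at_in in_chart_at A B)
  then have sub: "subspace (range ?T)"
    by (rule linear_subspace_image[OF _ subspace_UNIV])
  \<comment> \<open>Exchanging the two directions leaves \<open>Q v w\<close> unchanged and reverses
    the sign of the coefficient by \<open>skew\<close>; the difference is the doubled coefficient
    times \<open>h\<close>.\<close>
  from subspace_diff[OF sub Q[OF w(1) v(1)] Q[OF v(1) w(1)]]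
  have "(2 * ?g e (?J e'')) *\<^sub>R h \<in> range ?T"
    by (simp add: Qsym[of w v] w v skew algebra_simps flip: scaleR_add_left)
  from subspace_scale[OF sub this, of "inverse (2 * ?g e (?J e''))"]
  have "h \<in> tangent_space B A f p"
    using e'(2) e''(2) by (simp add: tangent_space_def)
  then show ?thesis
    using transversal_inter_tangent[OF LL bil sym h] by blast
qed

theorem theorem4p1:
  fixes A :: "('a::{t2_space,second_countable_topology}, 'e::euclidean_space) chart set"
    and B :: "('b::{t2_space,second_countable_topology}, 'f::euclidean_space) chart set"
    and J :: "'a \<Rightarrow> 'e \<Rightarrow> 'e"
    and g :: "'a \<Rightarrow> 'e \<Rightarrow> 'e \<Rightarrow> real"
    and C :: "'a \<Rightarrow> 'e \<Rightarrow> 'e \<Rightarrow> 'e"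
    and f :: "'b \<Rightarrow> 'a"
    and S St L D0 :: "'b \<Rightarrow> 'e set"
  assumes "indefinite_kaehler A J g C"
    and "STCR_lightlike_submanifold B A J g f S St L D0"
    and "\<forall>p. D0 p \<noteq> {0}"
    and "totally_umbilical B A g C f St L"
    and "integrable_distribution B (\<lambda>p. tangent_map B A f p -` D0 p)"
  shows "metric_connection B (induced_metric B A g f) (induced_connection B A C f St L)"
proof -
  obtain H where H: "\<And>p. H p \<in> transversal_space St L p"
    and umb: "\<And>X Y p. smooth_field B X \<Longrightarrow> smooth_field B Y \<Longrightarrow>
      second_fund_form B A C f St L X Y p = induced_metric B A g f p (X p) (Y p) *\<^sub>R H p"
    using assms(4) unfolding totally_umbilical_def by blast
  have "H p = 0" for p
    by (rule totally_umbilical_STCR_geodesic[OF assms(1,2) _ assms(5) H umb]) (use assms(3) in auto)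
  \<comment> \<open>With \<open>H = 0\<close> the definition of \<open>second_fund_form\<close>
    identifies the image of the induced connection under the tangent map with the ambient
    derivative; the description operator is never evaluated.\<close>
  then have conn: "tangent_map B A f p (induced_connection B A C f St L X Y p) =
      cov_deriv A C B f (push B A f Y) p (X p)" if "smooth_field B X" "smooth_field B Y" for X Y p
    using umb[OF that, of p] by (simp add: second_fund_form_def)
  obtain r where A: "smooth_atlas A" and g: "semi_riemannian_metric A g r" and lc: "levi_civita A g C"
    using assms(1) by (auto simp: indefinite_kaehler_def)
  have B: "smooth_atlas B" and f: "smooth_map B A f"
    using assms(2) by (auto simp: STCR_lightlike_submanifold_def lightlike_submanifold_def
        immersed_submanifold_def)
  show ?thesis
    unfolding metric_connection_def
  proof (intro allI impI)
    fix X Y Z p assume fields: "smooth_field B X" "smooth_field B Y" "smooth_field B Z"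
    show "dir_deriv B (\<lambda>q. induced_metric B A g f q (Y q) (Z q)) p (X p) -
        induced_metric B A g f p (induced_connection B A C f St L X Y p) (Z p) -
        induced_metric B A g f p (Y p) (induced_connection B A C f St L X Z p) = 0"
      \<comment> \<open>The induced metric sees its arguments only through the tangent map, so
        \<open>conn\<close> turns both subtracted terms into those of the compatibility formula
        along \<open>f\<close>.\<close>
      unfolding cov_deriv_metric_along[OF B A g lc f fields(2,3)]
      by (simp add: induced_metric_def conn fields push_def)
  qed
qed

end
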